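(* The non-compact orbit $\mathcal{O}_x^{n.c.}=\{gxg^{-1} : g\in SU(1,1)\}$ is isomorphic (diffeomorphic) to the quotient space $SU(1,1)/U(1)$, hence to $\mathbb{H}^2$: $$\mathcal{O}_x^{n.c.}\simeq SU(1,1)/U(1)\simeq \mathbb{H}^2,$$ and it can be parameterized by $\beta\in\mathbb{C}$ as follows. For $\beta\in\mathbb{C}$ put $$f_\beta := \begin{pmatrix}\cosh|\beta| & \frac{\beta}{|\beta|}\sinh|\beta|\\ \frac{\bar\beta}{|\beta|}\sinh|\beta| & \cosh|\beta|\end{pmatrix}\in SU(1,1).$$ The diffeomorphisms $\mathcal{O}_x^{n.c.}\to SU(1,1)/U(1)\to\mathbb{H}^2$ are given by $$\mathrm{Ad}(f_\beta)(x)\;\longmapsto\;[f_\beta]_{U(1)}\;\longmapsto\;\frac{\beta}{|\beta|}\tanh|\beta|,\qquad \beta\in\mathbb{C}.$$ The inverse diffeomorphisms $\mathbb{H}^2\to SU(1,1)/U(1)\to\mathcal{O}_x^{n.c.}$ are given, for $0\le r<1$ and $\theta\in\mathbb{R}$, by $$re^{i\theta}\;\longmapsto\;[h_{r,\theta}]_{U(1)}\;\longmapsto\;\mathrm{Ad}(h_{r,\theta})(x),$$ where $$h_{r,\theta} := \begin{pmatrix}\cosh\left(\frac12\ln\frac{1+r}{1-r}\right) & e^{i\theta}\sinh\left(\frac12\ln\frac{1+r}{1-r}\right)\\ e^{-i\theta}\sinh\left(\frac12\ln\frac{1+r}{1-r}\right) & \cosh\left(\frac12\ln\frac{1+r}{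1-r}\right)\end{pmatrix}.$$
   Context: $x:=\begin{pmatrix} i&0\\0&-i\end{pmatrix}$. $SU(1,1):=\left\{\begin{pmatrix}a&b\\ \bar b&\bar a\end{pmatrix} : a,b\in\mathbb{C},\ |a|^2-|b|^2=1\right\}$, with Lie algebra $\mathfrak{su}(1,1)=\left\{\begin{pmatrix} i\theta&\bar\beta\\ \beta&-i\theta\end{pmatrix}:\theta\in\mathbb{R},\beta\in\mathbb{C}\right\}\ni x$. $U(1):=\left\{\begin{pmatrix}e^{i\theta}&0\\0&e^{-i\theta}\end{pmatrix}:\theta\in\mathbb{R}\right\}$ is the stabilizer of $x$ under the adjoint action of $SU(1,1)$. $\mathrm{Ad}(g)(y)=gyg^{-1}$. $\mathcal{O}_x^{n.c.}$ is the orbit of $x$ under the adjoint action of $SU(1,1)$. $[g]_{U(1)}$ denotes the class of $g$ in the quotient $SU(1,1)/U(1)$. $\mathbb{H}^2=\{z\in\mathbb{C}:|z|<1\}$ is the hyperbolic (Poincaré) disc. For $\beta=0$, the expressions $\frac{\beta}{|\beta|}\sinh|\beta|$, $\frac{\bar\beta}{|\beta|}\sinh|\beta|$ and $\frac{\beta}{|\beta|}\tanh|\beta|$ are understood as $0$. *)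

theory Defs
  imports
    "HOL-Analysis.Analysis"
    "HOL-Algebra.Left_Coset"
    "HOL-Algebra.Group_Action"
begin

text \<open>For an open set \<open>S\<close>, \<open>Ck_on k S f\<close> says that \<open>f\<close> is of class \<open>C\<^sup>k\<close> on \<open>S\<close>.
  Continuity of all directional derivatives suffices since the domain is finite-dimensional.\<close>

primrec Ck_on ::
  "nat \<Rightarrow> 'a::euclidean_space set \<Rightarrow> ('a \<Rightarrow> 'b::euclidean_space) \<Rightarrow> bool" where
  "Ck_on 0 S f \<longleftrightarrow> continuous_on S f"
| "Ck_on (Suc k) S f \<longleftrightarrow>
     (\<forall>p\<in>S. f differentiable (at p)) \<and>
     (\<forall>v. Ck_on k S (\<lambda>p. frechet_derivative f (at p) v))"

text \<open>Smoothness (class \<open>C\<^sup>\<infinity>\<close>, over the reals) on an arbitrary subset \<open>S\<close>: local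
  extendability to a smooth map on an open subset of the ambient space. For open \<open>S\<close> this is
  ordinary smoothness, and for an embedded submanifold \<open>S\<close> it is smoothness on the manifold
  \<open>S\<close>.\<close>

definition smooth_on :: "'a::euclidean_space set \<Rightarrow> ('a \<Rightarrow> 'b::euclidean_space) \<Rightarrow> bool" where
  "smooth_on S f \<longleftrightarrow>
     (\<forall>p\<in>S. \<exists>U g. open U \<and> p \<in> U \<and> (\<forall>k. Ck_on k U g) \<and> (\<forall>q\<in>S \<inter> U. g q = f q))"

text \<open>A topological space with an atlas modelled on the Euclidean space \<open>'e\<close>. A chart
  \<open>(U, \<phi>)\<close> consists of its domain and a map of which only the values on \<open>U\<close> matter.\<close>

record ('a, 'e) charted_space =
  mtop :: "'a topology"
  atlas :: "('a set \<times> ('a \<Rightarrow> 'e)) set"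

abbreviation points :: "('a, 'e) charted_space \<Rightarrow> 'a set" where
  "points M \<equiv> topspace (mtop M)"

definition topological_chart ::
  "'a topology \<Rightarrow> 'a set \<Rightarrow> ('a \<Rightarrow> 'e::euclidean_space) \<Rightarrow> bool" where
  "topological_chart X U \<phi> \<longleftrightarrow>
     openin X U \<and> open (\<phi> ` U) \<and>
     homeomorphic_map (subtopology X U) (top_of_set (\<phi> ` U)) \<phi>"

definition smooth_manifold :: "('a, 'e::euclidean_space) charted_space \<Rightarrow> bool" where
  "smooth_manifold M \<longleftrightarrow>
     Hausdorff_space (mtop M) \<and> second_countable (mtop M) \<and>
     (\<forall>(U, \<phi>)\<in>atlas M. topological_chart (mtop M) U \<phi>) \<and>
     (\<Union>(U, \<phi>)\<in>atlas M. U) = points M \<and>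
     (\<forall>(U, \<phi>)\<in>atlas M. \<forall>(V, \<psi>)\<in>atlas M.
        smooth_on (\<phi> ` (U \<inter> V)) (\<psi> \<circ> inv_into U \<phi>))"

definition smooth_map ::
  "('a, 'd::euclidean_space) charted_space \<Rightarrow> ('b, 'e::euclidean_space) charted_space
    \<Rightarrow> ('a \<Rightarrow> 'b) \<Rightarrow> bool" where
  "smooth_map M N F \<longleftrightarrow>
     continuous_map (mtop M) (mtop N) F \<and>
     (\<forall>(U, \<phi>)\<in>atlas M. \<forall>(V, \<psi>)\<in>atlas N.
        smooth_on (\<phi> ` {p \<in> U. F p \<in> V}) (\<psi> \<circ> F \<circ> inv_into U \<phi>))"

definition diffeomorphism ::
  "('a, 'd::euclidean_space) charted_space \<Rightarrow> ('b, 'e::euclidean_space) charted_space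
    \<Rightarrow> ('a \<Rightarrow> 'b) \<Rightarrow> bool" where
  "diffeomorphism M N F \<longleftrightarrow>
     smooth_manifold M \<and> smooth_manifold N \<and>
     bij_betw F (points M) (points N) \<and>
     smooth_map M N F \<and> smooth_map N M (inv_into (points M) F)"

text \<open>The structure of an embedded submanifold \<open>S\<close> of a Euclidean space: the subspace topology
  with all charts that are smooth with smooth inverse as maps between subsets of Euclidean
  spaces. These charts cover \<open>S\<close> precisely when \<open>S\<close> is an embedded submanifold of dimension
  \<open>DIM('e)\<close>.\<close>

definition submanifold :: "'a::euclidean_space set \<Rightarrow> ('a, 'e::euclidean_space) charted_space" where
  "submanifold S = \<lparr>
     mtop = top_of_set S,
     atlas = {(U, \<phi>). topological_chart (top_of_set S) U \<phi> \<and>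
                      smooth_on U \<phi> \<and> smooth_on (\<phi> ` U) (inv_into U \<phi>)}\<rparr>"

definition quotient_topology :: "'a topology \<Rightarrow> ('a \<Rightarrow> 'b) \<Rightarrow> 'b topology" where
  "quotient_topology X \<pi> =
     topology (\<lambda>U. U \<subseteq> \<pi> ` topspace X \<and> openin X {p \<in> topspace X. \<pi> p \<in> U})"

lemma openin_quotient_topology:
  "openin (quotient_topology X \<pi>) U \<longleftrightarrow>
     U \<subseteq> \<pi> ` topspace X \<and> openin X {p \<in> topspace X. \<pi> p \<in> U}"
proof -
  have "istopology (\<lambda>U. U \<subseteq> \<pi> ` topspace X \<and> openin X {p \<in> topspace X. \<pi> p \<in> U})"
    unfolding istopology_def
  proof (intro conjI allI impI)
    fix S T
    assume "S \<subseteq> \<pi> ` topspace X \<and> openin X {p \<in> topspace X. \<pi> p \<in> S}"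
      and "T \<subseteq> \<pi> ` topspace X \<and> openin X {p \<in> topspace X. \<pi> p \<in> T}"
    moreover have "{p \<in> topspace X. \<pi> p \<in> S \<inter> T} =
        {p \<in> topspace X. \<pi> p \<in> S} \<inter> {p \<in> topspace X. \<pi> p \<in> T}" by auto
    ultimately show "S \<inter> T \<subseteq> \<pi> ` topspace X" "openin X {p \<in> topspace X. \<pi> p \<in> S \<inter> T}"
      by auto
  next
    fix \<K>
    assume *: "\<forall>K\<in>\<K>. K \<subseteq> \<pi> ` topspace X \<and> openin X {p \<in> topspace X. \<pi> p \<in> K}"
    then show "\<Union>\<K> \<subseteq> \<pi> ` topspace X" by blast
    have "{p \<in> topspace X. \<pi> p \<in> \<Union>\<K>} = (\<Union>K\<in>\<K>. {p \<in> topspace X. \<pi> p \<in> K})" by auto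
    with * show "openin X {p \<in> topspace X. \<pi> p \<in> \<Union>\<K>}" by auto
  qed
  then show ?thesis
    unfolding quotient_topology_def by (simp add: topology_inverse')
qed

lemma topspace_quotient_topology: "topspace (quotient_topology X \<pi>) = \<pi> ` topspace X"
proof
  show "topspace (quotient_topology X \<pi>) \<subseteq> \<pi> ` topspace X"
    unfolding topspace_def[of "quotient_topology X \<pi>"] openin_quotient_topology by blast
  have "{p \<in> topspace X. \<pi> p \<in> \<pi> ` topspace X} = topspace X" by auto
  then have "openin (quotient_topology X \<pi>) (\<pi> ` topspace X)"
    by (simp add: openin_quotient_topology)
  then show "\<pi> ` topspace X \<subseteq> topspace (quotient_topology X \<pi>)" by (rule openin_subset)
qed

lemma quotient_map_quotient_topology: "quotient_map X (quotient_topology X \<pi>) \<pi>"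
  by (auto simp: quotient_map_def topspace_quotient_topology openin_quotient_topology)

text \<open>The quotient \<open>G/H\<close> of left cosets of a matrix group \<open>G\<close>, with the quotient topology and
  the usual smooth structure of a homogeneous space. That structure is characterised by two
  properties: the projection \<open>\<pi> : G \<rightarrow> G/H\<close> is smooth, and \<open>\<pi>\<close> has smooth local sections around
  every point of \<open>G/H\<close>. Accordingly the charts are all topological charts \<open>(U, \<phi>)\<close> such that
  \<open>\<phi> \<circ> \<pi>\<close> is smooth on the preimage of \<open>U\<close>, and the inverse of \<open>\<phi>\<close> lifts locally to a smooth
  map \<open>\<sigma>\<close> into \<open>G\<close>.\<close>

definition homogeneous_space ::
  "('a::euclidean_space, 'm) monoid_scheme \<Rightarrow> 'a set
    \<Rightarrow> ('a set, 'e::euclidean_space) charted_space" where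
  "homogeneous_space G H = (let \<pi> = (\<lambda>g. g <#\<^bsub>G\<^esub> H);
       X = quotient_topology (top_of_set (carrier G)) \<pi>
     in \<lparr>mtop = X,
         atlas = {(U, \<phi>). topological_chart X U \<phi> \<and>
           smooth_on {g \<in> carrier G. \<pi> g \<in> U} (\<phi> \<circ> \<pi>) \<and>
           (\<forall>y\<in>\<phi> ` U. \<exists>W \<sigma>. open W \<and> y \<in> W \<and> W \<subseteq> \<phi> ` U \<and>
              smooth_on W \<sigma> \<and> \<sigma> ` W \<subseteq> carrier G \<and>
              (\<forall>w\<in>W. \<pi> (\<sigma> w) = inv_into U \<phi> w))}\<rparr>)"

definition mat2 :: "complex \<Rightarrow> complex \<Rightarrow> complex \<Rightarrow> complex \<Rightarrow> complex^2^2" where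
  "mat2 a b c d = vector [vector [a, b], vector [c, d]]"

definition SU11 :: "(complex^2^2) monoid" where
  "SU11 = \<lparr>carrier = {mat2 a b (cnj b) (cnj a) | a b. (cmod a)\<^sup>2 - (cmod b)\<^sup>2 = 1},
           mult = (**), one = mat 1\<rparr>"

definition U1 :: "(complex^2^2) set" where
  "U1 = {mat2 (exp (\<i> * of_real \<theta>)) 0 0 (exp (- \<i> * of_real \<theta>)) | \<theta>::real. True}"

definition Ad :: "complex^2^2 \<Rightarrow> complex^2^2 \<Rightarrow> complex^2^2" where
  "Ad g y = g ** y ** matrix_inv g"

definition x0 :: "complex^2^2" where
  "x0 = mat2 \<i> 0 0 (- \<i>)"

text \<open>All three manifolds have real dimension 2; the model space is \<open>complex\<close> viewed as a real
  Euclidean space. The orbit is a submanifold of the space of complex matrices, equivalently of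
  its linear subspace su(1,1).\<close>

definition nc_orbit :: "(complex^2^2, complex) charted_space" where
  "nc_orbit = submanifold (orbit SU11 Ad x0)"

lemma points_homogeneous_space: "points (homogeneous_space G H) = lcosets\<^bsub>G\<^esub> H"
  by (auto simp: homogeneous_space_def Let_def topspace_quotient_topology LCOSETS_def)

definition SU11_mod_U1 :: "((complex^2^2) set, complex) charted_space" where
  "SU11_mod_U1 = homogeneous_space SU11 U1"

definition H2 :: "(complex, complex) charted_space" where
  "H2 = submanifold {z. cmod z < 1}"

abbreviation cls :: "complex^2^2 \<Rightarrow> (complex^2^2) set" where
  "cls g \<equiv> g <#\<^bsub>SU11\<^esub> U1"

text \<open>For \<open>\<beta> = 0\<close> the off-diagonal entries are 0, as \<open>0 / 0 = 0\<close>.\<close>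

definition fmat :: "complex \<Rightarrow> complex^2^2" where
  "fmat \<beta> =
     mat2 (of_real (cosh (cmod \<beta>)))
          (\<beta> / of_real (cmod \<beta>) * of_real (sinh (cmod \<beta>)))
          (cnj \<beta> / of_real (cmod \<beta>) * of_real (sinh (cmod \<beta>)))
          (of_real (cosh (cmod \<beta>)))"

definition hmat :: "real \<Rightarrow> real \<Rightarrow> complex^2^2" where
  "hmat r \<theta> = (let t = 1/2 * ln ((1 + r) / (1 - r)) in
     mat2 (of_real (cosh t))
          (exp (\<i> * of_real \<theta>) * of_real (sinh t))
          (exp (- \<i> * of_real \<theta>) * of_real (sinh t))
          (of_real (cosh t)))"

end

theory Submission
  imports Defs
begin

text \<open>For \<open>g \<in> SU(1,1)\<close> with first row \<open>(a, b)\<close>, the number \<open>z = b / cnj a\<close> in the disc is a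
  complete invariant of the coset \<open>g U(1)\<close>, because \<open>\<bar>a\<bar>\<^sup>2 = 1 / (1 - \<bar>z\<bar>\<^sup>2)\<close> and \<open>g = \<sigma>(z) u\<close> with
  \<open>\<sigma>(z) = (1 - \<bar>z\<bar>\<^sup>2)\<^bsup>-1/2\<^esup> (1, z; cnj z, 1)\<close> and \<open>u = diag(a/\<bar>a\<bar>, cnj a/\<bar>a\<bar>) \<in> U(1)\<close>. The same \<open>z\<close> is a
  rational function of the entries of \<open>Ad g x0\<close>. Hence \<open>\<sigma>\<close> is a global smooth section over the
  disc and, through \<open>z\<close>, over the orbit; a global section together with a smooth invariant of
  cosets gives a diffeomorphism onto the homogeneous space. The matrices \<open>f\<^sub>\<beta>\<close> and \<open>h\<^sub>r\<^sub>,\<^sub>\<theta>\<close> have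
  coordinates \<open>z = (\<beta>/\<bar>\<beta>\<bar>) tanh \<bar>\<beta>\<bar>\<close> and \<open>z = r e\<^bsup>i\<theta>\<^esup>\<close>.\<close>

section \<open>Calculus of smooth maps\<close>

text \<open>On an open set a derivative depends only on nearby values, so agreement on
  \<open>S\<close> passes to all directional derivatives and the induction can continue with
  them.\<close>

lemma Ck_on_cong:
  assumes "open S" "\<And>q. q \<in> S \<Longrightarrow> f q = g q"
  shows "Ck_on k S f \<longleftrightarrow> Ck_on k S g"
  using assms(2)
proof (induction k arbitrary: f g)
  case 0
  then show ?case by (auto cong: continuous_on_cong)
next
  case (Suc k)
  have D: "(f has_derivative D) (at p) \<longleftrightarrow> (g has_derivative D) (at p)" if "p \<in> S" for p D
    using assms(1) that Suc.prems has_derivative_transform_within_open by metis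
  have "f differentiable at p \<longleftrightarrow> g differentiable at p" if "p \<in> S" for p
    using D[OF that] by (simp add: differentiable_def)
  moreover have "Ck_on k S (\<lambda>p. frechet_derivative f (at p) v)
      \<longleftrightarrow> Ck_on k S (\<lambda>p. frechet_derivative g (at p) v)" for v
    \<comment> \<open>\<open>frechet_derivative\<close> is a choice among the derivatives at
      \<open>p\<close>; by \<open>D\<close> both functions offer the same candidates, hence the same
      choice.\<close>
    by (rule Suc.IH) (simp add: frechet_derivative_def D)
  ultimately show ?case by simp
qed

text \<open>Uniqueness of the derivative lets an explicit formula \<open>D\<close> replace the
  choice in \<open>frechet_derivative\<close>. The closure properties below all exhibit such a
  formula.\<close>

lemma Ck_on_SucI:
  assumes "open S" "\<And>p. p \<in> S \<Longrightarrow> (f has_derivative D p) (at p)"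
    and "\<And>v. Ck_on k S (\<lambda>p. D p v)"
  shows "Ck_on (Suc k) S f"
proof -
  have "Ck_on k S (\<lambda>p. frechet_derivative f (at p) v)" for v
    using assms(3) Ck_on_cong[OF assms(1), of "\<lambda>p. frechet_derivative f (at p) v" "\<lambda>p. D p v"]
      frechet_derivative_at[OF assms(2)] by simp
  then show ?thesis
    using assms(2) by (auto simp: differentiable_def)
qed

lemma Ck_on_SucD:
  assumes "Ck_on (Suc k) S f"
  shows "p \<in> S \<Longrightarrow> (f has_derivative frechet_derivative f (at p)) (at p)"
    and "Ck_on k S (\<lambda>p. frechet_derivative f (at p) v)"
  using assms by (auto simp: frechet_derivative_works)

lemma Ck_on_imp_continuous_on: "Ck_on k S f \<Longrightarrow> continuous_on S f"
  using differentiable_imp_continuous_on[OF differentiable_at_imp_differentiable_on, of S f]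
  by (cases k) auto

lemma Ck_on_lower: "Ck_on (Suc k) S f \<Longrightarrow> Ck_on k S f"
proof (induction k arbitrary: f)
  case 0
  then show ?case using Ck_on_imp_continuous_on[OF 0] by simp
next
  case (Suc k)
  have "Ck_on k S (\<lambda>p. frechet_derivative f (at p) v)" for v
    by (rule Suc.IH) (rule Ck_on_SucD(2)[OF Suc.prems])
  then show ?case using Suc.prems by simp
qed

text \<open>Derivatives are taken at \<open>p\<close> in the whole space, so shrinking
  \<open>S\<close> only removes conditions.\<close>

lemma Ck_on_subset: "Ck_on k S f \<Longrightarrow> T \<subseteq> S \<Longrightarrow> Ck_on k T f"
  by (induction k arbitrary: f) (auto intro: continuous_on_subset)

lemma Ck_on_const: "open S \<Longrightarrow> Ck_on k S (\<lambda>_. c)"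
proof (induction k arbitrary: c)
  case (Suc k)
  show ?case
    by (rule Ck_on_SucI[where D = "\<lambda>_ _. 0"]) (use Suc in auto)
qed auto

lemma Ck_on_id: "open S \<Longrightarrow> Ck_on k S (\<lambda>x. x)"
  by (cases k) (auto intro!: continuous_on_id Ck_on_SucI[where D = "\<lambda>_ v. v"] Ck_on_const)

lemma Ck_on_bounded_linear:
  assumes "bounded_linear L" "open S"
  shows "Ck_on k S f \<Longrightarrow> Ck_on k S (\<lambda>p. L (f p))"
proof (induction k arbitrary: f)
  case 0
  then show ?case by (simp add: bounded_linear.continuous_on[OF assms(1)])
next
  case (Suc k)
  show ?case
    by (rule Ck_on_SucI[where D = "\<lambda>p v. L (frechet_derivative f (at p) v)"])
      (auto intro: assms(2) Suc.IH bounded_linear.has_derivative[OF assms(1)] Ck_on_SucD[OF Suc.prems])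
qed

lemma Ck_on_add:
  assumes "open S"
  shows "Ck_on k S f \<Longrightarrow> Ck_on k S g \<Longrightarrow> Ck_on k S (\<lambda>p. f p + g p)"
proof (induction k arbitrary: f g)
  case 0
  then show ?case by (simp add: continuous_on_add)
next
  case (Suc k)
  show ?case
    by (rule Ck_on_SucI[where
          D = "\<lambda>p v. frechet_derivative f (at p) v + frechet_derivative g (at p) v"])
      (auto intro!: assms Suc.IH has_derivative_add Ck_on_SucD[OF Suc.prems(1)]
        Ck_on_SucD[OF Suc.prems(2)] simp del: Ck_on.simps)
qed

lemma Ck_on_sum:
  assumes "open S" "finite I" "\<And>i. i \<in> I \<Longrightarrow> Ck_on k S (f i)"
  shows "Ck_on k S (\<lambda>p. \<Sum>i\<in>I. f i p)"
  using assms(2,3)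
  by (induction I rule: finite_induct) (simp_all add: Ck_on_const Ck_on_add assms(1))

text \<open>By the product rule a directional derivative is a sum of two terms of the form
  \<open>B\<close> again, one factor being differentiated and the other only lowered to class
  C^k.\<close>

lemma Ck_on_bounded_bilinear:
  assumes "bounded_bilinear B" "open S"
  shows "Ck_on k S f \<Longrightarrow> Ck_on k S g \<Longrightarrow> Ck_on k S (\<lambda>p. B (f p) (g p))"
proof (induction k arbitrary: f g)
  case 0
  then show ?case by (simp add: bounded_bilinear.continuous_on[OF assms(1)])
next
  case (Suc k)
  show ?case
  proof (rule Ck_on_SucI[where
          D = "\<lambda>p v. B (f p) (frechet_derivative g (at p) v) + B (frechet_derivative f (at p) v) (g p)"])
    show "((\<lambda>p. B (f p) (g p)) has_derivative
        (\<lambda>v. B (f p) (frechet_derivative g (at p) v) + B (frechet_derivative f (at p) v) (g p))) (at p)"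
      if "p \<in> S" for p
      by (intro bounded_bilinear.FDERIV[OF assms(1)] Ck_on_SucD(1)[OF Suc.prems(1)]
          Ck_on_SucD(1)[OF Suc.prems(2)] that)
    show "Ck_on k S (\<lambda>p. B (f p) (frechet_derivative g (at p) v)
        + B (frechet_derivative f (at p) v) (g p))" for v
      by (intro Ck_on_add Suc.IH assms(2) Ck_on_lower[OF Suc.prems(1)] Ck_on_lower[OF Suc.prems(2)]
          Ck_on_SucD(2)[OF Suc.prems(1)] Ck_on_SucD(2)[OF Suc.prems(2)])
  qed (rule assms)
qed

lemma Ck_on_compose:
  fixes f :: "'a::euclidean_space \<Rightarrow> 'b::euclidean_space" and g :: "'b \<Rightarrow> 'c::euclidean_space"
  assumes "open S" "open T" "f ` S \<subseteq> T"
  shows "Ck_on k S f \<Longrightarrow> Ck_on k T g \<Longrightarrow> Ck_on k S (\<lambda>p. g (f p))"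
proof (induction k arbitrary: g)
  case 0
  then show ?case using assms(3) by (auto intro: continuous_on_compose2)
next
  case (Suc k)
  define D where "D p v = frechet_derivative g (at (f p)) (frechet_derivative f (at p) v)" for p v
  show ?case
  proof (rule Ck_on_SucI[where D = D])
    fix p assume p: "p \<in> S"
    then have "f p \<in> T" using assms(3) by auto
    then show "((\<lambda>p. g (f p)) has_derivative D p) (at p)"
      using diff_chain_at[OF Ck_on_SucD(1)[OF Suc.prems(1) p] Ck_on_SucD(1)[OF Suc.prems(2)]]
      by (simp add: D_def[abs_def] o_def)
  next
    fix v
    \<comment> \<open>The induction hypothesis handles derivatives of \<open>g\<close> in a fixed
      direction, but here the direction moves with \<open>p\<close>. Expanding it in the basis
      leaves fixed directions \<open>b\<close> with scalar coefficients of class C^k.\<close>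
    have "D p v = (\<Sum>b\<in>Basis. (frechet_derivative f (at p) v \<bullet> b) *\<^sub>R
        frechet_derivative g (at (f p)) b)" if "p \<in> S" for p
    proof -
      have "linear (frechet_derivative g (at (f p)))"
        using Ck_on_SucD(1)[OF Suc.prems(2)] assms(3) that has_derivative_linear by blast
      then have "frechet_derivative g (at (f p)) (\<Sum>b\<in>Basis. (w \<bullet> b) *\<^sub>R b)
          = (\<Sum>b\<in>Basis. (w \<bullet> b) *\<^sub>R frechet_derivative g (at (f p)) b)" for w
        by (simp add: linear_sum linear_scale)
      from this[of "frechet_derivative f (at p) v"] show ?thesis by (simp add: D_def euclidean_representation)
    qed
    moreover have "Ck_on k S (\<lambda>p. \<Sum>b\<in>Basis. (frechet_derivative f (at p) v \<bullet> b) *\<^sub>R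
        frechet_derivative g (at (f p)) b)"
      by (intro Ck_on_sum assms(1) finite_Basis Ck_on_bounded_bilinear[OF bounded_bilinear_scaleR]
          Ck_on_bounded_linear[OF bounded_linear_inner_left] Ck_on_SucD(2)[OF Suc.prems(1)]
          Suc.IH Ck_on_SucD(2)[OF Suc.prems(2)] Ck_on_lower[OF Suc.prems(1)])
    ultimately show "Ck_on k S (\<lambda>p. D p v)"
      by (subst Ck_on_cong[OF assms(1)])
  qed (rule assms)
qed

text \<open>The derivative is a multiple of another power, so the exponent varies in the induction.
  Exponents -1 and -1/2 later provide reciprocals and inverse square roots.\<close>

lemma Ck_on_powr: "Ck_on k {0<..} (\<lambda>x::real. x powr s)"
proof (induction k arbitrary: s)
  case 0
  then show ?case by (auto intro!: continuous_intros)
next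
  case (Suc k)
  show ?case
  proof (rule Ck_on_SucI[where D = "\<lambda>x v. v * (s * x powr (s - 1))"])
    show "((\<lambda>x. x powr s) has_derivative (\<lambda>v. v * (s * x powr (s - 1)))) (at x)"
      if "x \<in> {0<..}" for x :: real
      using has_real_derivative_powr[of x s] that
      by (simp add: has_field_derivative_def mult_commute_abs)
    show "Ck_on k {0<..} (\<lambda>x. v * (s * x powr (s - 1)))" for v
      by (intro Ck_on_bounded_linear[OF bounded_linear_mult_right] Suc.IH open_greaterThan)
  qed auto
qed

section \<open>Smooth maps on arbitrary subsets\<close>

lemma smooth_onE:
  assumes "smooth_on S f" "p \<in> S"
  obtains U g where "open U" "p \<in> U" "\<And>k. Ck_on k U g" "\<And>q. q \<in> S \<Longrightarrow> q \<in> U \<Longrightarrow> g q = f q"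
  using bspec[OF assms(1)[unfolded smooth_on_def] assms(2)] by auto

lemma smooth_onI:
  assumes "\<And>p. p \<in> S \<Longrightarrow> \<exists>U g. open U \<and> p \<in> U \<and> (\<forall>k. Ck_on k U g) \<and> (\<forall>q\<in>S \<inter> U. g q = f q)"
  shows "smooth_on S f"
  unfolding smooth_on_def using assms by (intro ballI)

lemma smooth_on_subset:
  assumes "smooth_on S f" "T \<subseteq> S"
  shows "smooth_on T f"
proof (rule smooth_onI)
  fix p assume "p \<in> T"
  obtain U g where "open U" "p \<in> U" "\<And>k. Ck_on k U g"
    "\<And>q. q \<in> S \<Longrightarrow> q \<in> U \<Longrightarrow> g q = f q"
    by (rule smooth_onE[OF assms(1), of p]) (use \<open>p \<in> T\<close> assms(2) in auto)
  with assms(2)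
  show "\<exists>U g. open U \<and> p \<in> U \<and> (\<forall>k. Ck_on k U g) \<and> (\<forall>q\<in>T \<inter> U. g q = f q)"
    by (intro exI[of _ U] exI[of _ g]) auto
qed

lemma smooth_on_cong:
  assumes "\<And>q. q \<in> S \<Longrightarrow> f q = g q"
  shows "smooth_on S f \<longleftrightarrow> smooth_on S g"
  unfolding smooth_on_def by (simp add: assms)

lemma smooth_on_eq: "smooth_on S f \<Longrightarrow> (\<And>p. p \<in> S \<Longrightarrow> f p = g p) \<Longrightarrow> smooth_on S g"
  using smooth_on_cong[of S f g] by simp

text \<open>Meant for coset spaces, where lifts to the group are only given locally. Cutting the
  extension's domain down to \<open>W\<close> makes it agree with \<open>f\<close> on all of
  \<open>S\<close> that it meets.\<close>

lemma smooth_on_locally: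
  assumes "\<And>p. p \<in> S \<Longrightarrow> \<exists>W. open W \<and> p \<in> W \<and> smooth_on (S \<inter> W) f"
  shows "smooth_on S f"
proof (rule smooth_onI)
  fix p assume "p \<in> S"
  then obtain W where W: "open W" "p \<in> W" "smooth_on (S \<inter> W) f" using assms by blast
  obtain U g where U: "open U" "p \<in> U" "\<And>k. Ck_on k U g"
    "\<And>q. q \<in> S \<inter> W \<Longrightarrow> q \<in> U \<Longrightarrow> g q = f q"
    by (rule smooth_onE[OF W(3), of p]) (use \<open>p \<in> S\<close> W in auto)
  have "Ck_on k (U \<inter> W) g" for k
    by (rule Ck_on_subset[OF U(3)]) simp
  with U W
  show "\<exists>U g. open U \<and> p \<in> U \<and> (\<forall>k. Ck_on k U g) \<and> (\<forall>q\<in>S \<inter> U. g q = f q)"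
    by (intro exI[of _ "U \<inter> W"] exI[of _ g]) auto
qed

lemma smooth_on_openI: "open S \<Longrightarrow> (\<And>k. Ck_on k S f) \<Longrightarrow> smooth_on S f"
  unfolding smooth_on_def by (intro ballI exI[of _ S] exI[of _ f]) simp

lemma smooth_on_imp_continuous_on:
  assumes "smooth_on S f"
  shows "continuous_on S f"
  unfolding continuous_on_eq_continuous_within
proof
  fix p assume "p \<in> S"
  obtain U g where U: "open U" "p \<in> U" "\<And>k. Ck_on k U g"
    "\<And>q. q \<in> S \<Longrightarrow> q \<in> U \<Longrightarrow> g q = f q"
    by (rule smooth_onE[OF assms \<open>p \<in> S\<close>]) auto
  have "continuous_on (S \<inter> U) g"
    by (rule continuous_on_subset[OF Ck_on_imp_continuous_on[OF U(3)[of 0]]]) simp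
  then have "continuous_on (S \<inter> U) f"
    using continuous_on_cong[of "S \<inter> U" "S \<inter> U" g f] U(4) by simp
  then have "continuous (at p within S \<inter> U) f"
    using \<open>p \<in> S\<close> U(2) by (simp add: continuous_on_eq_continuous_within)
  \<comment> \<open>Limits at \<open>p\<close> are local, so passing from \<open>S\<close> to the
    part inside the neighbourhood \<open>U\<close> changes nothing.\<close>
  moreover have "at p within S = at p within S \<inter> U"
    by (rule at_within_nhd[OF U(2,1)]) auto
  ultimately show "continuous (at p within S) f" by (simp only: continuous_within)
qed

lemma smooth_on_compose:
  assumes "smooth_on S f" "smooth_on T g" "f ` S \<subseteq> T"
  shows "smooth_on S (\<lambda>p. g (f p))"
proof (rule smooth_onI)
  fix p assume "p \<in> S"
  obtain U f' where U: "open U" "p \<in> U" "\<And>k. Ck_on k U f'"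
    "\<And>q. q \<in> S \<Longrightarrow> q \<in> U \<Longrightarrow> f' q = f q"
    by (rule smooth_onE[OF assms(1) \<open>p \<in> S\<close>]) auto
  have "f p \<in> T" using \<open>p \<in> S\<close> assms(3) by auto
  obtain V g' where V: "open V" "f p \<in> V" "\<And>k. Ck_on k V g'"
    "\<And>q. q \<in> T \<Longrightarrow> q \<in> V \<Longrightarrow> g' q = g q"
    by (rule smooth_onE[OF assms(2) \<open>f p \<in> T\<close>]) auto
  \<comment> \<open>The preimage is formed with the extension \<open>f'\<close>, which is continuous
    on the open set \<open>U\<close>; a preimage under \<open>f\<close> would only be open relative
    to \<open>S\<close>.\<close>
  define W where "W = U \<inter> f' -` V"
  have "open W"
    unfolding W_def
    by (rule continuous_open_preimage[OF Ck_on_imp_continuous_on[OF U(3)[of 0]] U(1) V(1)])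
  moreover have "Ck_on k W (\<lambda>p. g' (f' p))" for k
    by (rule Ck_on_compose[OF \<open>open W\<close> V(1) _ Ck_on_subset[OF U(3)] V(3)]) (auto simp: W_def)
  ultimately show "\<exists>U h. open U \<and> p \<in> U \<and> (\<forall>k. Ck_on k U h) \<and> (\<forall>q\<in>S \<inter> U. h q = g (f q))"
    using U V \<open>p \<in> S\<close> assms(3)
    by (intro exI[of _ W] exI[of _ "\<lambda>p. g' (f' p)"]) (auto simp: W_def image_subset_iff)
qed

lemma smooth_on_const: "smooth_on S (\<lambda>_. c)"
  by (rule smooth_on_subset[of UNIV]) (auto intro: smooth_on_openI Ck_on_const)


lemma smooth_on_id: "smooth_on S (\<lambda>x. x)"
  by (rule smooth_on_subset[of UNIV]) (auto intro: smooth_on_openI Ck_on_id)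

lemma smooth_on_bounded_linear:
  assumes "bounded_linear L" "smooth_on S f"
  shows "smooth_on S (\<lambda>p. L (f p))"
proof (rule smooth_on_compose[OF assms(2), where T = UNIV])
  show "smooth_on UNIV L"
    by (intro smooth_on_openI Ck_on_bounded_linear[OF assms(1)] Ck_on_id open_UNIV)
qed auto

lemma smooth_on_bounded_bilinear:
  assumes "bounded_bilinear B" "smooth_on S f" "smooth_on S g"
  shows "smooth_on S (\<lambda>p. B (f p) (g p))"
proof (rule smooth_onI)
  fix p assume "p \<in> S"
  obtain U f' where U: "open U" "p \<in> U" "\<And>k. Ck_on k U f'"
    "\<And>q. q \<in> S \<Longrightarrow> q \<in> U \<Longrightarrow> f' q = f q"
    by (rule smooth_onE[OF assms(2) \<open>p \<in> S\<close>]) auto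
  obtain V g' where V: "open V" "p \<in> V" "\<And>k. Ck_on k V g'"
    "\<And>q. q \<in> S \<Longrightarrow> q \<in> V \<Longrightarrow> g' q = g q"
    by (rule smooth_onE[OF assms(3) \<open>p \<in> S\<close>]) auto
  have "Ck_on k (U \<inter> V) (\<lambda>p. B (f' p) (g' p))" for k
    using U V by (intro Ck_on_bounded_bilinear[OF assms(1)]) (auto intro: Ck_on_subset)
  with U V show "\<exists>W h. open W \<and> p \<in> W \<and> (\<forall>k. Ck_on k W h) \<and> (\<forall>q\<in>S \<inter> W. h q = B (f q) (g q))"
    by (intro exI[of _ "U \<inter> V"] exI[of _ "\<lambda>p. B (f' p) (g' p)"]) auto
qed

lemma smooth_on_add:
  assumes "smooth_on S f" "smooth_on S g"
  shows "smooth_on S (\<lambda>p. f p + g p)"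
proof (rule smooth_onI)
  fix p assume "p \<in> S"
  obtain U f' where U: "open U" "p \<in> U" "\<And>k. Ck_on k U f'"
    "\<And>q. q \<in> S \<Longrightarrow> q \<in> U \<Longrightarrow> f' q = f q"
    by (rule smooth_onE[OF assms(1) \<open>p \<in> S\<close>]) auto
  obtain V g' where V: "open V" "p \<in> V" "\<And>k. Ck_on k V g'"
    "\<And>q. q \<in> S \<Longrightarrow> q \<in> V \<Longrightarrow> g' q = g q"
    by (rule smooth_onE[OF assms(2) \<open>p \<in> S\<close>]) auto
  have "Ck_on k (U \<inter> V) (\<lambda>p. f' p + g' p)" for k
    using U V by (intro Ck_on_add) (auto intro: Ck_on_subset)
  with U V show "\<exists>W h. open W \<and> p \<in> W \<and> (\<forall>k. Ck_on k W h) \<and> (\<forall>q\<in>S \<inter> W. h q = f q + g q)"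
    by (intro exI[of _ "U \<inter> V"] exI[of _ "\<lambda>p. f' p + g' p"]) auto
qed

lemma smooth_on_powr:
  fixes f :: "'a::euclidean_space \<Rightarrow> real"
  assumes "smooth_on S f" "\<And>p. p \<in> S \<Longrightarrow> f p > 0"
  shows "smooth_on S (\<lambda>p. f p powr s)"
proof (rule smooth_on_compose[OF assms(1)])
  show "smooth_on {0<..} (\<lambda>x::real. x powr s)"
    by (intro smooth_on_openI open_greaterThan Ck_on_powr)
qed (use assms(2) in auto)

section \<open>Manifolds with a global chart and homogeneous spaces\<close>

lemma topological_chart_inj_on: "topological_chart X U \<phi> \<Longrightarrow> inj_on \<phi> U"
  using openin_subset[of X U]
  by (auto simp: topological_chart_def homeomorphic_eq_everything_map Int_absorb1)

lemma topological_chart_subset: "topological_chart X U \<phi> \<Longrightarrow> U \<subseteq> topspace X"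
  by (simp add: topological_chart_def openin_subset)

text \<open>A chart on the whole space is a homeomorphism onto a subspace of a Euclidean space, from
  which both properties are inherited.\<close>

lemma global_chart_topology:
  fixes X :: "'a topology" and \<phi> :: "'a \<Rightarrow> 'b::euclidean_space"
  assumes "topological_chart X (topspace X) \<phi>"
  shows "Hausdorff_space X" "second_countable X"
proof -
  have X: "X homeomorphic_space top_of_set (\<phi> ` topspace X)"
    using assms homeomorphic_map_imp_homeomorphic_space by (fastforce simp: topological_chart_def)
  show "Hausdorff_space X"
    by (simp add: homeomorphic_Hausdorff_space[OF X] Hausdorff_space_subtopology)
  show "second_countable X"
    unfolding homeomorphic_space_second_countability[OF X]
  proof (rule second_countable_subtopology)
    obtain B :: "'b set set" where "countable B" "\<And>C. C \<in> B \<Longrightarrow> open C"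
      "\<And>S. open S \<Longrightarrow> \<exists>U. U \<subseteq> B \<and> S = \<Union>U"
      by (rule univ_second_countable) blast
    then show "second_countable (euclidean :: 'b topology)"
      unfolding second_countable_def open_openin[symmetric] by (metis Union_iff Union_upper subset_iff)
  qed
qed

lemma smooth_map_chartsD:
  assumes "smooth_map M N F" "(U, \<phi>) \<in> atlas M" "(V, \<psi>) \<in> atlas N"
  shows "smooth_on (\<phi> ` {p \<in> U. F p \<in> V}) (\<psi> \<circ> F \<circ> inv_into U \<phi>)"
  using bspec[OF bspec[OF conjunct2[OF assms(1)[unfolded smooth_map_def]] assms(2), unfolded prod.case]
      assms(3)] by simp

text \<open>Chart domains of a manifold lie inside \<open>points M\<close>, so values elsewhere
  never enter. This matters for \<open>inv_into\<close>, which is controlled only on the image of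
  its set.\<close>

lemma smooth_map_cong:
  assumes "smooth_manifold M" "\<And>p. p \<in> points M \<Longrightarrow> F p = F' p"
  shows "smooth_map M N F \<longleftrightarrow> smooth_map M N F'"
proof -
  have *: "smooth_map M N F'" if F_smooth: "smooth_map M N F" and F: "\<And>p. p \<in> points M \<Longrightarrow> F p = F' p" for F F'
    unfolding smooth_map_def
  proof (intro conjI)
    show "continuous_map (mtop M) (mtop N) F'"
      by (rule continuous_map_eq[OF _ F]) (use F_smooth in \<open>simp_all add: smooth_map_def\<close>)
  next
    show "\<forall>(U, \<phi>)\<in>atlas M. \<forall>(V, \<psi>)\<in>atlas N.
        smooth_on (\<phi> ` {p \<in> U. F' p \<in> V}) (\<psi> \<circ> F' \<circ> inv_into U \<phi>)"
    proof (clarify)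
      fix U \<phi> V \<psi> assume UV: "(U, \<phi>) \<in> atlas M" "(V, \<psi>) \<in> atlas N"
      then have U: "U \<subseteq> points M"
        using assms(1) topological_chart_subset[of "mtop M" U \<phi>] by (auto simp: smooth_manifold_def)
      have "smooth_on (\<phi> ` {p \<in> U. F p \<in> V}) (\<psi> \<circ> F \<circ> inv_into U \<phi>)"
        by (rule smooth_map_chartsD[OF F_smooth UV])
      moreover have "{p \<in> U. F p \<in> V} = {p \<in> U. F' p \<in> V}"
        using U F by auto
      moreover have "(\<psi> \<circ> F \<circ> inv_into U \<phi>) q = (\<psi> \<circ> F' \<circ> inv_into U \<phi>) q"
        if q: "q \<in> \<phi> ` {p \<in> U. F' p \<in> V}" for q
      proof -
        have "inv_into U \<phi> q \<in> points M" using U q inv_into_into[of q \<phi> U] by auto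
        then show ?thesis by (simp add: F)
      qed
      ultimately show "smooth_on (\<phi> ` {p \<in> U. F' p \<in> V}) (\<psi> \<circ> F' \<circ> inv_into U \<phi>)"
        using smooth_on_cong[of "\<phi> ` {p \<in> U. F' p \<in> V}" "\<psi> \<circ> F \<circ> inv_into U \<phi>"
            "\<psi> \<circ> F' \<circ> inv_into U \<phi>"] by simp
    qed
  qed
  show ?thesis using *[of F F'] *[of F' F] assms(2) by metis
qed

lemma diffeomorphism_inv_into:
  assumes "diffeomorphism M N F"
  shows "diffeomorphism N M (inv_into (points M) F)"
  unfolding diffeomorphism_def
proof (intro conjI)
  have bij: "bij_betw F (points M) (points N)" and M: "smooth_manifold M" "smooth_map M N F"
    using assms by (auto simp: diffeomorphism_def)
  show "bij_betw (inv_into (points M) F) (points N) (points M)"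
    by (rule bij_betw_inv_into[OF bij])
  show "smooth_map M N (inv_into (points N) (inv_into (points M) F))"
    using M(2)
    \<comment> \<open>Inverting twice gives back \<open>F\<close> on \<open>points M\<close>
      only.\<close>
    by (subst smooth_map_cong[OF M(1), of _ F]) (simp_all add: inv_into_inv_into_eq[OF bij])
qed (use assms in \<open>auto simp: diffeomorphism_def\<close>)

section \<open>Embedded submanifolds of Euclidean spaces\<close>

lemma atlas_submanifold:
  "(U, \<phi>) \<in> atlas (submanifold S) \<longleftrightarrow> topological_chart (top_of_set S) U \<phi> \<and>
     smooth_on U \<phi> \<and> smooth_on (\<phi> ` U) (inv_into U \<phi>)"
  by (simp add: submanifold_def)

text \<open>The global chart settles the topology and the covering. Transition maps are smooth for
  any two charts of this atlas, because the inverse of one and the other chart are both smooth in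
  the ambient sense.\<close>

lemma smooth_manifold_submanifold:
  fixes \<phi> :: "'s::euclidean_space \<Rightarrow> 'e::euclidean_space"
  assumes "(S, \<phi>) \<in> atlas (submanifold S)"
  shows "smooth_manifold (submanifold S :: ('s, 'e) charted_space)"
  unfolding smooth_manifold_def
proof (intro conjI)
  let ?M = "submanifold S :: ('s, 'e) charted_space"
  have X: "mtop ?M = top_of_set S" "points ?M = S" by (simp_all add: submanifold_def)
  show "Hausdorff_space (mtop ?M)" "second_countable (mtop ?M)"
    using global_chart_topology[of "top_of_set S" \<phi>] assms
    by (simp_all add: X atlas_submanifold)
  show "\<forall>(U, \<phi>)\<in>atlas ?M. topological_chart (mtop ?M) U \<phi>"
    by (auto simp: X atlas_submanifold)
  have "U \<subseteq> S" if "(U, \<phi>) \<in> atlas ?M" for U \<phi>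
    using that topological_chart_subset[of "top_of_set S" U \<phi>] by (simp add: atlas_submanifold)
  then show "(\<Union>(U, \<phi>)\<in>atlas ?M. U) = points ?M"
    unfolding X by (intro equalityI subsetI) (auto intro!: bexI[OF _ assms])
  show "\<forall>(U, \<phi>)\<in>atlas ?M. \<forall>(V, \<psi>)\<in>atlas ?M. smooth_on (\<phi> ` (U \<inter> V)) (\<psi> \<circ> inv_into U \<phi>)"
  proof clarify
    fix U \<phi> V \<psi> assume UV: "(U, \<phi>) \<in> atlas ?M" "(V, \<psi>) \<in> atlas ?M"
    then have "inj_on \<phi> U" by (auto simp: atlas_submanifold topological_chart_inj_on)
    then have "inv_into U \<phi> ` \<phi> ` (U \<inter> V) \<subseteq> V" by auto
    moreover have "smooth_on (\<phi> ` (U \<inter> V)) (inv_into U \<phi>)" "smooth_on V \<psi>"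
      using UV by (auto simp: atlas_submanifold intro: smooth_on_subset)
    ultimately show "smooth_on (\<phi> ` (U \<inter> V)) (\<psi> \<circ> inv_into U \<phi>)"
      using smooth_on_compose[of "\<phi> ` (U \<inter> V)" "inv_into U \<phi>" V \<psi>] by (simp add: o_def)
  qed
qed

section \<open>Homogeneous spaces and smooth maps into and out of them\<close>

lemma mtop_homogeneous_space:
  "mtop (homogeneous_space G H) = quotient_topology (top_of_set (carrier G)) (\<lambda>g. g <#\<^bsub>G\<^esub> H)"
  by (simp add: homogeneous_space_def Let_def)

lemma atlas_homogeneous_space:
  fixes \<phi> :: "'a::euclidean_space set \<Rightarrow> 'e::euclidean_space"
  shows "(U, \<phi>) \<in> atlas (homogeneous_space G H) \<longleftrightarrow>
     topological_chart (mtop (homogeneous_space G H :: ('a set, 'e) charted_space)) U \<phi> \<and>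
     smooth_on {g \<in> carrier G. g <#\<^bsub>G\<^esub> H \<in> U} (\<lambda>g. \<phi> (g <#\<^bsub>G\<^esub> H)) \<and>
     (\<forall>y\<in>\<phi> ` U. \<exists>W \<sigma>. open W \<and> y \<in> W \<and> W \<subseteq> \<phi> ` U \<and>
        smooth_on W \<sigma> \<and> \<sigma> ` W \<subseteq> carrier G \<and> (\<forall>w\<in>W. \<sigma> w <#\<^bsub>G\<^esub> H = inv_into U \<phi> w))"
  by (simp add: homogeneous_space_def Let_def o_def)

text \<open>Descent along the projection: near each \<open>y\<close> the local lift \<sigma> writes
  \<open>F\<close> in the chart as the smooth map g \<mapsto> F (g H) composed with
  \<sigma>.\<close>

lemma homogeneous_space_smooth_on:
  fixes \<phi> :: "'a::euclidean_space set \<Rightarrow> 'e::euclidean_space"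
    and F :: "'a set \<Rightarrow> 'b::euclidean_space"
  assumes "(U, \<phi>) \<in> atlas (homogeneous_space G H)" "A \<subseteq> U"
    and "smooth_on {g \<in> carrier G. g <#\<^bsub>G\<^esub> H \<in> A} (\<lambda>g. F (g <#\<^bsub>G\<^esub> H))"
  shows "smooth_on (\<phi> ` A) (F \<circ> inv_into U \<phi>)"
proof (rule smooth_on_locally)
  fix y assume y: "y \<in> \<phi> ` A"
  then obtain W \<sigma> where W: "open W" "y \<in> W" "smooth_on W \<sigma>" "\<sigma> ` W \<subseteq> carrier G"
    "\<And>w. w \<in> W \<Longrightarrow> \<sigma> w <#\<^bsub>G\<^esub> H = inv_into U \<phi> w"
    using assms(1,2) unfolding atlas_homogeneous_space by (meson image_mono subsetD)
  have inj: "inj_on \<phi> U"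
    using assms(1) topological_chart_inj_on by (auto simp: atlas_homogeneous_space)
  have "inv_into U \<phi> w \<in> A" if "w \<in> \<phi> ` A" for w
    using that inj assms(2) by (auto simp: subset_iff)
  then have "smooth_on (\<phi> ` A \<inter> W) (\<lambda>w. F (\<sigma> w <#\<^bsub>G\<^esub> H))"
    using W by (intro smooth_on_compose[OF smooth_on_subset[OF W(3)] assms(3)]) auto
  then have "smooth_on (\<phi> ` A \<inter> W) (F \<circ> inv_into U \<phi>)"
    using smooth_on_cong[of "\<phi> ` A \<inter> W" "\<lambda>w. F (\<sigma> w <#\<^bsub>G\<^esub> H)" "F \<circ> inv_into U \<phi>"] W(5) by simp
  with W show "\<exists>W. open W \<and> y \<in> W \<and> smooth_on (\<phi> ` A \<inter> W) (F \<circ> inv_into U \<phi>)" by blast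
qed

lemma smooth_manifold_homogeneous_space:
  fixes \<phi> :: "'a::euclidean_space set \<Rightarrow> 'e::euclidean_space"
  assumes "(lcosets\<^bsub>G\<^esub> H, \<phi>) \<in> atlas (homogeneous_space G H)"
  shows "smooth_manifold (homogeneous_space G H :: ('a set, 'e) charted_space)"
  unfolding smooth_manifold_def
proof (intro conjI)
  let ?M = "homogeneous_space G H :: ('a set, 'e) charted_space"
  show "Hausdorff_space (mtop ?M)" "second_countable (mtop ?M)"
    using global_chart_topology[of "mtop ?M" \<phi>] assms
    by (simp_all add: points_homogeneous_space atlas_homogeneous_space)
  show "\<forall>(U, \<phi>)\<in>atlas ?M. topological_chart (mtop ?M) U \<phi>"
    by (auto simp: atlas_homogeneous_space)
  have "U \<subseteq> points ?M" if "(U, \<phi>) \<in> atlas ?M" for U \<phi>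
    using that topological_chart_subset[of "mtop ?M" U \<phi>] by (simp add: atlas_homogeneous_space)
  then show "(\<Union>(U, \<phi>)\<in>atlas ?M. U) = points ?M"
    unfolding points_homogeneous_space by (intro equalityI subsetI) (auto intro!: bexI[OF _ assms])
  show "\<forall>(U, \<phi>)\<in>atlas ?M. \<forall>(V, \<psi>)\<in>atlas ?M. smooth_on (\<phi> ` (U \<inter> V)) (\<psi> \<circ> inv_into U \<phi>)"
  proof clarify
    fix U \<phi> V \<psi> assume UV: "(U, \<phi>) \<in> atlas ?M" "(V, \<psi>) \<in> atlas ?M"
    then have "smooth_on {g \<in> carrier G. g <#\<^bsub>G\<^esub> H \<in> V} (\<lambda>g. \<psi> (g <#\<^bsub>G\<^esub> H))"
      by (simp add: atlas_homogeneous_space)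
    then have "smooth_on {g \<in> carrier G. g <#\<^bsub>G\<^esub> H \<in> U \<inter> V} (\<lambda>g. \<psi> (g <#\<^bsub>G\<^esub> H))"
      by (rule smooth_on_subset) auto
    then show "smooth_on (\<phi> ` (U \<inter> V)) (\<psi> \<circ> inv_into U \<phi>)"
      by (intro homogeneous_space_smooth_on[OF UV(1)]) auto
  qed
qed

text \<open>The projection is continuous by the choice of topology, and a chart composed with it is
  smooth by the choice of atlas; both are then composed with \<open>s\<close>.\<close>

lemma smooth_map_into_homogeneous_space:
  fixes s :: "'s::euclidean_space \<Rightarrow> 'a::euclidean_space"
  assumes "smooth_on S s" "s ` S \<subseteq> carrier G"
  shows "smooth_map (submanifold S :: ('s, 'd::euclidean_space) charted_space)
    (homogeneous_space G H :: ('a set, 'e::euclidean_space) charted_space) (\<lambda>p. s p <#\<^bsub>G\<^esub> H)"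
  (is "smooth_map ?M ?N ?F")
  unfolding smooth_map_def
proof (intro conjI)
  have "continuous_map (top_of_set S) (top_of_set (carrier G)) s"
    using smooth_on_imp_continuous_on[OF assms(1)] assms(2) by auto
  then have "continuous_map (top_of_set S) (mtop ?N) ((\<lambda>g. g <#\<^bsub>G\<^esub> H) \<circ> s)"
    unfolding mtop_homogeneous_space
    by (rule continuous_map_compose[OF _ quotient_imp_continuous_map[OF quotient_map_quotient_topology]])
  then show "continuous_map (mtop ?M) (mtop ?N) ?F" by (simp add: submanifold_def o_def)
  show "\<forall>(U, \<phi>)\<in>atlas ?M. \<forall>(V, \<psi>)\<in>atlas ?N.
      smooth_on (\<phi> ` {p \<in> U. ?F p \<in> V}) (\<psi> \<circ> ?F \<circ> inv_into U \<phi>)"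
  proof clarify
    fix U \<phi> V \<psi> assume UV: "(U, \<phi>) \<in> atlas ?M" "(V, \<psi>) \<in> atlas ?N"
    define D where "D = \<phi> ` {p \<in> U. ?F p \<in> V}"
    have U: "U \<subseteq> S" "inj_on \<phi> U"
      using UV topological_chart_subset[of "top_of_set S" U \<phi>] topological_chart_inj_on[of "top_of_set S" U \<phi>]
      by (simp_all add: atlas_submanifold)
    have D: "inv_into U \<phi> ` D \<subseteq> {p \<in> U. ?F p \<in> V}"
      using U(2) by (auto simp: D_def)
    have "smooth_on D (inv_into U \<phi>)"
      by (rule smooth_on_subset[of "\<phi> ` U"]) (use UV in \<open>auto simp: atlas_submanifold D_def\<close>)
    then have "smooth_on D (\<lambda>y. s (inv_into U \<phi> y))"
      by (rule smooth_on_compose[OF _ assms(1)]) (use D U in auto)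
    then have "smooth_on D (\<lambda>y. \<psi> (s (inv_into U \<phi> y) <#\<^bsub>G\<^esub> H))"
      by (rule smooth_on_compose[where T = "{g \<in> carrier G. g <#\<^bsub>G\<^esub> H \<in> V}" and
            g = "\<lambda>g. \<psi> (g <#\<^bsub>G\<^esub> H)"])
        (use UV D U assms(2) in \<open>auto simp: atlas_homogeneous_space\<close>)
    then show "smooth_on (\<phi> ` {p \<in> U. ?F p \<in> V}) (\<psi> \<circ> ?F \<circ> inv_into U \<phi>)"
      by (simp add: D_def o_def)
  qed
qed

text \<open>The universal property of the quotient: continuity descends along the quotient map,
  smoothness by \<open>homogeneous_space_smooth_on\<close>.\<close>

lemma smooth_map_from_homogeneous_space:
  fixes m :: "'a::euclidean_space \<Rightarrow> 's::euclidean_space"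
  assumes "smooth_on (carrier G) m" "m ` carrier G \<subseteq> S"
    and F: "\<And>g. g \<in> carrier G \<Longrightarrow> F (g <#\<^bsub>G\<^esub> H) = m g"
  shows "smooth_map (homogeneous_space G H :: ('a set, 'e::euclidean_space) charted_space)
    (submanifold S :: ('s, 'd::euclidean_space) charted_space) F"
  (is "smooth_map ?M ?N _")
  unfolding smooth_map_def
proof (intro conjI)
  have "continuous_map (top_of_set (carrier G)) (top_of_set S) m"
    using smooth_on_imp_continuous_on[OF assms(1)] assms(2) by auto
  then have "continuous_map (top_of_set (carrier G)) (top_of_set S) (F \<circ> (\<lambda>g. g <#\<^bsub>G\<^esub> H))"
    by (rule continuous_map_eq) (simp add: F)
  then have "continuous_map (mtop ?M) (top_of_set S) F"
    unfolding mtop_homogeneous_space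
    by (rule continuous_compose_quotient_map[OF quotient_map_quotient_topology])
  then show "continuous_map (mtop ?M) (mtop ?N) F" by (simp add: submanifold_def)
  show "\<forall>(U, \<phi>)\<in>atlas ?M. \<forall>(V, \<psi>)\<in>atlas ?N.
      smooth_on (\<phi> ` {p \<in> U. F p \<in> V}) (\<psi> \<circ> F \<circ> inv_into U \<phi>)"
  proof clarify
    fix U \<phi> V \<psi> assume UV: "(U, \<phi>) \<in> atlas ?M" "(V, \<psi>) \<in> atlas ?N"
    define A where "A = {g \<in> carrier G. g <#\<^bsub>G\<^esub> H \<in> {p \<in> U. F p \<in> V}}"
    have "smooth_on A m"
      by (rule smooth_on_subset[OF assms(1)]) (auto simp: A_def)
    then have "smooth_on A (\<lambda>g. \<psi> (m g))"
      by (rule smooth_on_compose[where T = V])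
        (use UV in \<open>auto simp: atlas_submanifold A_def F\<close>)
    then have "smooth_on A (\<lambda>g. (\<psi> \<circ> F) (g <#\<^bsub>G\<^esub> H))"
      using smooth_on_cong[of A "\<lambda>g. \<psi> (m g)" "\<lambda>g. (\<psi> \<circ> F) (g <#\<^bsub>G\<^esub> H)"] F by (simp add: A_def)
    then show "smooth_on (\<phi> ` {p \<in> U. F p \<in> V}) (\<psi> \<circ> F \<circ> inv_into U \<phi>)"
      using homogeneous_space_smooth_on[OF UV(1), of "{p \<in> U. F p \<in> V}" "\<psi> \<circ> F"]
      by (auto simp: A_def)
  qed
qed

section \<open>Quotients presented by a global section\<close>

text \<open>A pair of smooth maps \<open>s : S \<rightarrow> G\<close> and \<open>m : G \<rightarrow> S\<close> presenting \<open>G/H\<close> as \<open>S\<close>: \<open>m\<close> is a complete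
  invariant of the coset and \<open>s\<close> is a global section.\<close>

locale smooth_section =
  fixes G :: "('a::euclidean_space, 'x) monoid_scheme" and H :: "'a set"
    and S :: "'s::euclidean_space set" and s :: "'s \<Rightarrow> 'a" and m :: "'a \<Rightarrow> 's"
  assumes smooth_s: "smooth_on S s" and s_carrier: "\<And>p. p \<in> S \<Longrightarrow> s p \<in> carrier G"
    and smooth_m: "smooth_on (carrier G) m" and m_S: "\<And>g. g \<in> carrier G \<Longrightarrow> m g \<in> S"
    and m_s: "\<And>p. p \<in> S \<Longrightarrow> m (s p) = p"
    and s_m: "\<And>g. g \<in> carrier G \<Longrightarrow> s (m g) <#\<^bsub>G\<^esub> H = g <#\<^bsub>G\<^esub> H"
    and m_coset: "\<And>g h. g \<in> carrier G \<Longrightarrow> h \<in> carrier G \<Longrightarrow> g <#\<^bsub>G\<^esub> H = h <#\<^bsub>G\<^esub> H \<Longrightarrow> m g = m h"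
begin

definition to_coset :: "'s \<Rightarrow> 'a set" where
  "to_coset p = s p <#\<^bsub>G\<^esub> H"

lemma inj_on_to_coset: "inj_on to_coset S"
  using m_coset m_s s_carrier unfolding inj_on_def to_coset_def by metis

lemma to_coset_image: "to_coset ` S = lcosets\<^bsub>G\<^esub> H"
proof
  show "to_coset ` S \<subseteq> lcosets\<^bsub>G\<^esub> H" using s_carrier by (auto simp: to_coset_def LCOSETS_def)
  have "g <#\<^bsub>G\<^esub> H = to_coset (m g)" if "g \<in> carrier G" for g
    using s_m[OF that] by (simp add: to_coset_def)
  then show "lcosets\<^bsub>G\<^esub> H \<subseteq> to_coset ` S" using m_S by (auto simp: LCOSETS_def)
qed

lemma to_coset_m: "g \<in> carrier G \<Longrightarrow> to_coset (m g) = g <#\<^bsub>G\<^esub> H"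
  by (simp add: to_coset_def s_m)

lemma inv_into_to_coset: "g \<in> carrier G \<Longrightarrow> inv_into S to_coset (g <#\<^bsub>G\<^esub> H) = m g"
  using to_coset_m[of g] m_S[of g] inj_on_to_coset inv_into_f_f by metis

lemma smooth_to_coset:
  "smooth_map (submanifold S :: ('s, 'd::euclidean_space) charted_space)
    (homogeneous_space G H :: ('a set, 'e::euclidean_space) charted_space) to_coset"
  using smooth_map_into_homogeneous_space[OF smooth_s, of G H] s_carrier
  by (auto simp: to_coset_def[abs_def])

lemma smooth_inv_to_coset:
  "smooth_map (homogeneous_space G H :: ('a set, 'e::euclidean_space) charted_space)
    (submanifold S :: ('s, 'd::euclidean_space) charted_space) (inv_into S to_coset)"
  by (rule smooth_map_from_homogeneous_space[OF smooth_m]) (auto simp: m_S inv_into_to_coset)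

lemma diffeomorphism_to_coset:
  assumes "smooth_manifold (submanifold S :: ('s, 'd::euclidean_space) charted_space)"
    and "smooth_manifold (homogeneous_space G H :: ('a set, 'e::euclidean_space) charted_space)"
  shows "diffeomorphism (submanifold S :: ('s, 'd) charted_space)
    (homogeneous_space G H :: ('a set, 'e) charted_space) to_coset"
proof -
  have "points (submanifold S :: ('s, 'd) charted_space) = S" by (simp add: submanifold_def)
  then show ?thesis
    using assms smooth_to_coset smooth_inv_to_coset inj_on_to_coset to_coset_image
    by (simp add: diffeomorphism_def points_homogeneous_space bij_betw_def)
qed

text \<open>When \<open>S\<close> is open it can be its own model: the inverse of
  \<open>to_coset\<close> is a global chart with image \<open>S\<close>, and \<open>s\<close> is the
  lift demanded by the atlas.\<close>

lemma smooth_manifold_cosets: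
  assumes "open S"
  shows "smooth_manifold (homogeneous_space G H :: ('a set, 's) charted_space)"
proof (rule smooth_manifold_homogeneous_space)
  let ?M = "homogeneous_space G H :: ('a set, 's) charted_space"
  let ?\<phi> = "inv_into S to_coset"
  have img: "?\<phi> ` (lcosets\<^bsub>G\<^esub> H) = S"
    using inj_on_to_coset by (simp flip: to_coset_image)
  have "homeomorphic_maps (mtop ?M) (top_of_set S) ?\<phi> to_coset"
    \<comment> \<open>Only the continuity contained in these two facts enters; the type instances
      make the coset space coincide with \<open>?M\<close>.\<close>
    using smooth_to_coset[where ?'d = 's and ?'e = 's] smooth_inv_to_coset[where ?'d = 's and ?'e = 's]
      inj_on_to_coset
    by (auto simp: homeomorphic_maps_def smooth_map_def submanifold_def points_homogeneous_space
        f_inv_into_f simp flip: to_coset_image)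
  then have "topological_chart (mtop ?M) (lcosets\<^bsub>G\<^esub> H) ?\<phi>"
    unfolding topological_chart_def img
    using assms homeomorphic_maps_imp_map subtopology_topspace[of "mtop ?M"] openin_topspace[of "mtop ?M"]
    by (auto simp: points_homogeneous_space)
  moreover have "smooth_on {g \<in> carrier G. g <#\<^bsub>G\<^esub> H \<in> lcosets\<^bsub>G\<^esub> H} (\<lambda>g. ?\<phi> (g <#\<^bsub>G\<^esub> H))"
    using smooth_on_cong[of "{g \<in> carrier G. g <#\<^bsub>G\<^esub> H \<in> lcosets\<^bsub>G\<^esub> H}" "\<lambda>g. ?\<phi> (g <#\<^bsub>G\<^esub> H)" m]
      smooth_on_subset[OF smooth_m] inv_into_to_coset by auto
  moreover have "\<forall>w\<in>S. s w <#\<^bsub>G\<^esub> H = inv_into (lcosets\<^bsub>G\<^esub> H) ?\<phi> w"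
    using inj_on_to_coset inv_into_inv_into_eq[of to_coset S "lcosets\<^bsub>G\<^esub> H"] to_coset_image
    by (auto simp: bij_betw_def to_coset_def)
  ultimately show "(lcosets\<^bsub>G\<^esub> H, ?\<phi>) \<in> atlas ?M"
    unfolding atlas_homogeneous_space img using assms smooth_s s_carrier by blast
qed

end

section \<open>The orbit, the quotient and the disc\<close>

lemma smooth_on_mult:
  fixes f g :: "'a::euclidean_space \<Rightarrow> complex"
  shows "smooth_on S f \<Longrightarrow> smooth_on S g \<Longrightarrow> smooth_on S (\<lambda>p. f p * g p)"
  by (rule smooth_on_bounded_bilinear[OF bounded_bilinear_mult])

lemma mat2_nth [simp]:
  "mat2 a b c d $ 1 $ 1 = a" "mat2 a b c d $ 1 $ 2 = b"
  "mat2 a b c d $ 2 $ 1 = c" "mat2 a b c d $ 2 $ 2 = d"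
  by (simp_all add: mat2_def)

lemma mat2_eq_iff [simp]: "mat2 a b c d = mat2 a' b' c' d' \<longleftrightarrow> a = a' \<and> b = b' \<and> c = c' \<and> d = d'"
  by (metis mat2_nth)

lemma mat2_mult: "mat2 a b c d ** mat2 a' b' c' d' =
    mat2 (a * a' + b * c') (a * b' + b * d') (c * a' + d * c') (c * b' + d * d')"
  by (simp add: vec_eq_iff forall_2 matrix_matrix_mult_def sum_2)

lemma mat2_one: "mat 1 = mat2 1 0 0 1"
  by (simp add: vec_eq_iff forall_2 mat_def)

lemma matrix_inv_mat2:
  assumes "a * d - b * c = 1"
  shows "matrix_inv (mat2 a b c d) = mat2 d (- b) (- c) a"
proof -
  let ?A = "mat2 a b c d" and ?B = "mat2 d (- b) (- c) a"
  have B: "?A ** ?B = mat 1 \<and> ?B ** ?A = mat 1"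
    using assms by (simp add: mat2_mult mat2_one algebra_simps)
  \<comment> \<open>\<open>matrix_inv\<close> chooses some two-sided inverse. The adjugate
    \<open>?B\<close> shows that one exists, and uniqueness then identifies the choice with
    \<open>?B\<close>.\<close>
  then have "?A ** matrix_inv ?A = mat 1 \<and> matrix_inv ?A ** ?A = mat 1"
    unfolding matrix_inv_def by (rule someI)
  with B show ?thesis by (metis matrix_mul_assoc matrix_mul_lid matrix_mul_rid)
qed

lemma smooth_on_mat2:
  fixes f g h k :: "'a::euclidean_space \<Rightarrow> complex"
  assumes "smooth_on S f" "smooth_on S g" "smooth_on S h" "smooth_on S k"
  shows "smooth_on S (\<lambda>p. mat2 (f p) (g p) (h p) (k p))"
proof -
  have "linear (\<lambda>a. mat2 a 0 0 0)" "linear (\<lambda>b. mat2 0 b 0 0)"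
    "linear (\<lambda>c. mat2 0 0 c 0)" "linear (\<lambda>d. mat2 0 0 0 d)"
    by (auto intro!: linearI simp: vec_eq_iff forall_2)
  then have "smooth_on S (\<lambda>p. mat2 (f p) 0 0 0 + mat2 0 (g p) 0 0 + mat2 0 0 (h p) 0 + mat2 0 0 0 (k p))"
    using assms by (intro smooth_on_add)
      (auto simp: linear_conv_bounded_linear intro: smooth_on_bounded_linear)
  moreover have "mat2 a 0 0 0 + mat2 0 b 0 0 + mat2 0 0 c 0 + mat2 0 0 0 d = mat2 a b c d" for a b c d
    by (simp add: vec_eq_iff forall_2)
  ultimately show ?thesis by simp
qed

lemma smooth_on_nth_nth:
  fixes A :: "'a::euclidean_space \<Rightarrow> complex^2^2"
  assumes "smooth_on S A"
  shows "smooth_on S (\<lambda>p. A p $ i $ j)"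
  by (rule smooth_on_bounded_linear[OF _ assms])
    (simp add: bounded_linear_compose[OF bounded_linear_vec_nth bounded_linear_vec_nth])

text \<open>The modulus is not smooth at 0, but its square is Re (f * cnj f), a real quadratic
  expression.\<close>

lemma smooth_on_cmod_power2:
  fixes f :: "'a::euclidean_space \<Rightarrow> complex"
  assumes "smooth_on S f"
  shows "smooth_on S (\<lambda>p. (cmod (f p))\<^sup>2)"
proof -
  have "smooth_on S (\<lambda>p. Re (f p * cnj (f p)))"
    by (intro smooth_on_bounded_linear[OF bounded_linear_Re] smooth_on_mult assms
        smooth_on_bounded_linear[OF bounded_linear_cnj])
  then show ?thesis by (simp add: complex_mult_cnj cmod_power2)
qed

lemmas smooth_on_intros = smooth_on_id smooth_on_const smooth_on_mult smooth_on_mat2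
  smooth_on_add smooth_on_nth_nth smooth_on_cmod_power2
  smooth_on_bounded_linear[OF bounded_linear_cnj]
  smooth_on_bounded_linear[OF bounded_linear_Im]
  smooth_on_bounded_linear[OF bounded_linear_of_real]
  smooth_on_bounded_linear[OF bounded_linear_minus[OF bounded_linear_ident]]

section \<open>SU(1,1) and the cosets of U(1)\<close>

lemma mem_SU11_iff:
  "mat2 a b c d \<in> carrier SU11 \<longleftrightarrow> c = cnj b \<and> d = cnj a \<and> (cmod a)\<^sup>2 - (cmod b)\<^sup>2 = 1"
  by (auto simp: SU11_def)

lemma SU11E:
  assumes "g \<in> carrier SU11"
  obtains a b where "g = mat2 a b (cnj b) (cnj a)" "(cmod a)\<^sup>2 = 1 + (cmod b)\<^sup>2" "a \<noteq> 0"
proof -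
  obtain a b where *: "g = mat2 a b (cnj b) (cnj a)" "(cmod a)\<^sup>2 = 1 + (cmod b)\<^sup>2"
    using assms by (auto simp: SU11_def)
  moreover have "a \<noteq> 0"
    using *(2) power_not_zero[of "1 + (cmod b)\<^sup>2"] by (auto simp: add_nonneg_eq_0_iff)
  ultimately show ?thesis by (rule that)
qed

lemma l_coset_SU11: "g <#\<^bsub>SU11\<^esub> U1 = (\<lambda>u. g ** u) ` U1"
  by (auto simp: l_coset_def SU11_def)

lemma U1_mult: "u \<in> U1 \<Longrightarrow> v \<in> U1 \<Longrightarrow> u ** v \<in> U1"
  unfolding U1_def
proof clarify
  fix \<theta> \<eta> :: real
  show "\<exists>\<zeta>::real. mat2 (exp (\<i> * \<theta>)) 0 0 (exp (- \<i> * \<theta>)) ** mat2 (exp (\<i> * \<eta>)) 0 0 (exp (- \<i> * \<eta>))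
      = mat2 (exp (\<i> * \<zeta>)) 0 0 (exp (- \<i> * \<zeta>)) \<and> True"
    by (intro exI[of _ "\<theta> + \<eta>"]) (simp add: mat2_mult exp_add[symmetric] algebra_simps)
qed

lemma U1_one: "mat 1 \<in> U1"
  unfolding U1_def mat2_one by (auto intro!: exI[of _ 0])

lemma U1_inverse: "u \<in> U1 \<Longrightarrow> \<exists>v\<in>U1. u ** v = mat 1"
  unfolding U1_def
proof clarify
  fix \<theta> :: real
  show "\<exists>v\<in>{mat2 (exp (\<i> * \<theta>)) 0 0 (exp (- \<i> * \<theta>)) |\<theta>::real. True}.
      mat2 (exp (\<i> * \<theta>)) 0 0 (exp (- \<i> * \<theta>)) ** v = mat 1"
    by (rule bexI[of _ "mat2 (exp (\<i> * (- \<theta>))) 0 0 (exp (- \<i> * (- \<theta>)))"])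
      (auto simp: mat2_mult mat2_one exp_minus_inverse exp_add[symmetric] intro!: exI[of _ "- \<theta>"])
qed

text \<open>Multiplication by \<open>u\<close> permutes \<open>U1\<close>: closure gives one
  inclusion, the inverse \<open>v\<close> the other.\<close>

lemma cls_mult_U1:
  assumes "u \<in> U1"
  shows "cls (g ** u) = cls g"
proof -
  obtain v where v: "v \<in> U1" "u ** v = mat 1" using U1_inverse assms by blast
  have 1: "g ** w = (g ** u) ** (v ** w)" for w
    using v(2) by (metis matrix_mul_assoc matrix_mul_rid)
  have 2: "(g ** u) ** w = g ** (u ** w)" for w
    by (simp add: matrix_mul_assoc)
  show ?thesis
    unfolding l_coset_SU11
  proof (intro equalityI image_subsetI)
    show "(g ** u) ** w \<in> (\<lambda>u. g ** u) ` U1" if "w \<in> U1" for w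
      unfolding 2 using U1_mult[OF assms that] by (rule imageI)
    show "g ** w \<in> (\<lambda>w. (g ** u) ** w) ` U1" if "w \<in> U1" for w
      unfolding 1[of w] using U1_mult[OF v(1) that] by (rule imageI)
  qed
qed

section \<open>The disc coordinate, its section and the orbit\<close>

text \<open>On SU(1,1) this is the image of 0 under the Moebius action z \<mapsto> (a z + b) / (cnj
  b z + cnj a), in which the stabilizer of 0 is U(1).\<close>

definition disc_coord :: "complex^2^2 \<Rightarrow> complex" where
  "disc_coord g = g $ 1 $ 2 / cnj (g $ 1 $ 1)"

text \<open>For |z| < 1 this matrix is Hermitian and positive definite, so
  \<open>SU11_decomposition\<close> is the polar decomposition.\<close>

definition disc_section :: "complex \<Rightarrow> complex^2^2" where
  "disc_section z = (let c = complex_of_real (1 / sqrt (1 - (cmod z)\<^sup>2)) in mat2 c (c * z) (c * cnj z) c)"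

text \<open>The value of \<open>disc_coord g\<close>, read off from the matrix \<open>Ad g x0\<close>.\<close>

definition orbit_coord :: "complex^2^2 \<Rightarrow> complex" where
  "orbit_coord Y = \<i> * Y $ 1 $ 2 / of_real (1 + Im (Y $ 1 $ 1))"

text \<open>The entries involve only a b and the two moduli, which do not change when a and b are
  multiplied by opposite phases; hence U(1) fixes \<open>x0\<close>.\<close>

lemma Ad_x0:
  assumes "g = mat2 a b (cnj b) (cnj a)" "(cmod a)\<^sup>2 = 1 + (cmod b)\<^sup>2"
  shows "Ad g x0 = mat2 (\<i> * of_real ((cmod a)\<^sup>2 + (cmod b)\<^sup>2)) (- 2 * \<i> * (a * b))
    (2 * \<i> * cnj (a * b)) (- \<i> * of_real ((cmod a)\<^sup>2 + (cmod b)\<^sup>2))"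
proof -
  have ab: "a * cnj a = of_real ((cmod a)\<^sup>2)" "b * cnj b = of_real ((cmod b)\<^sup>2)"
    by (simp_all only: complex_norm_square)
  then have "a * cnj a - b * cnj b = 1" by (simp add: assms(2))
  from matrix_inv_mat2[OF this] have "Ad g x0 = mat2 (\<i> * (a * cnj a + b * cnj b)) (- 2 * \<i> * (a * b))
    (2 * \<i> * cnj (a * b)) (- \<i> * (a * cnj a + b * cnj b))"
    by (simp add: assms(1) Ad_def x0_def mat2_mult algebra_simps)
  then show ?thesis by (simp add: ab)
qed

lemma orbit_coord_Ad:
  assumes "g \<in> carrier SU11"
  shows "orbit_coord (Ad g x0) = disc_coord g"
proof -
  from assms obtain a b where g: "g = mat2 a b (cnj b) (cnj a)" "(cmod a)\<^sup>2 = 1 + (cmod b)\<^sup>2" "a \<noteq> 0"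
    by (rule SU11E)
  have Y: "Ad g x0 $ 1 $ 2 = - 2 * \<i> * (a * b)" "Im (Ad g x0 $ 1 $ 1) = (cmod a)\<^sup>2 + (cmod b)\<^sup>2"
    unfolding Ad_x0[OF g(1,2)] mat2_nth by simp_all
  \<comment> \<open>The relation |a|^2 - |b|^2 = 1 turns the denominator into 2 a cnj a, so a
    cancels against the numerator 2 a b.\<close>
  have "1 + ((cmod a)\<^sup>2 + (cmod b)\<^sup>2) = 2 * (cmod a)\<^sup>2" by (simp add: g(2))
  then have d: "complex_of_real (1 + ((cmod a)\<^sup>2 + (cmod b)\<^sup>2)) = 2 * (a * cnj a)"
    by (simp only: complex_norm_square of_real_mult of_real_numeral)
  have "orbit_coord (Ad g x0) = \<i> * (- 2 * \<i> * (a * b)) / (2 * (a * cnj a))"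
    by (simp only: orbit_coord_def Y d)
  also have "\<dots> = disc_coord g" using g(3) by (simp add: disc_coord_def g(1))
  finally show ?thesis .
qed

text \<open>The orbit lies on the upper sheet of a two-sheeted hyperboloid; this keeps the
  denominator of \<open>orbit_coord\<close> positive.\<close>

lemma Im_orbit: "g \<in> carrier SU11 \<Longrightarrow> Im (Ad g x0 $ 1 $ 1) > 0"
  by (erule SU11E) (simp add: Ad_x0 add_nonneg_pos)

lemma disc_coord_in_disc:
  assumes "g \<in> carrier SU11"
  shows "cmod (disc_coord g) < 1"
proof -
  from assms obtain a b where g: "g = mat2 a b (cnj b) (cnj a)" "(cmod a)\<^sup>2 = 1 + (cmod b)\<^sup>2" "a \<noteq> 0"
    by (rule SU11E)
  have "cmod b < cmod a" by (rule power_less_imp_less_base[of _ 2]) (simp_all add: g(2))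
  then show ?thesis using g(3) by (simp add: disc_coord_def g(1) norm_divide)
qed

lemma disc_section_in_SU11:
  assumes "cmod z < 1"
  shows "disc_section z \<in> carrier SU11"
proof -
  have "(cmod z)\<^sup>2 < 1" using assms by (simp add: abs_square_less_1)
  then show ?thesis
    by (simp add: disc_section_def Let_def mem_SU11_iff norm_mult norm_divide power_mult_distrib
        power_divide field_simps)
qed

lemma disc_coord_section: "cmod z < 1 \<Longrightarrow> disc_coord (disc_section z) = z"
  by (auto simp: disc_section_def Let_def disc_coord_def abs_square_eq_1)

lemma SU11_decomposition:
  assumes "g \<in> carrier SU11"
  shows "\<exists>u\<in>U1. g = disc_section (disc_coord g) ** u"
proof -
  from assms obtain a b where g: "g = mat2 a b (cnj b) (cnj a)" "(cmod a)\<^sup>2 = 1 + (cmod b)\<^sup>2" "a \<noteq> 0"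
    by (rule SU11E)
  have "1 - (cmod (disc_coord g))\<^sup>2 = (1 / cmod a)\<^sup>2"
  proof -
    have "1 - (cmod (disc_coord g))\<^sup>2 = ((cmod a)\<^sup>2 - (cmod b)\<^sup>2) / (cmod a)\<^sup>2"
      using g(3) by (simp add: disc_coord_def g(1) norm_divide power_divide diff_divide_distrib)
    then show ?thesis by (simp add: g(2) power_divide)
  qed
  then have c: "1 / sqrt (1 - (cmod (disc_coord g))\<^sup>2) = cmod a" by simp
  \<comment> \<open>\<open>U1\<close> is given by angles, so the phase a / |a| is written as the
    exponential of \<open>Arg a\<close>.\<close>
  have e: "exp (\<i> * Arg a) = a / cmod a"
    using g(3) by (metis Arg_eq nonzero_mult_div_cancel_left norm_eq_zero of_real_eq_0_iff)
  have e': "exp (- \<i> * Arg a) = cnj a / cmod a"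
    using arg_cong[OF e, of cnj] by (simp add: exp_cnj)
  let ?u = "mat2 (exp (\<i> * Arg a)) 0 0 (exp (- \<i> * Arg a))"
  have "?u \<in> U1" unfolding U1_def by blast
  moreover have "g = disc_section (disc_coord g) ** ?u"
    unfolding e e' using g(3)
    by (simp add: disc_section_def Let_def c) (simp add: mat2_mult disc_coord_def g(1))
  ultimately show ?thesis by blast
qed

lemma cls_disc_section: "g \<in> carrier SU11 \<Longrightarrow> cls (disc_section (disc_coord g)) = cls g"
  using SU11_decomposition cls_mult_U1 by metis

text \<open>The two matrices differ by a right factor in \<open>U1\<close>, which changes neither
  the product of the first-row entries nor their moduli; by \<open>Ad_x0\<close> the conjugates of
  \<open>x0\<close> agree.\<close>

lemma Ad_disc_section:
  assumes "g \<in> carrier SU11"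
  shows "Ad (disc_section (disc_coord g)) x0 = Ad g x0"
proof -
  obtain u where u: "u \<in> U1" "g = disc_section (disc_coord g) ** u"
    using SU11_decomposition[OF assms] by blast
  from disc_section_in_SU11[OF disc_coord_in_disc[OF assms]]
  obtain a b where h: "disc_section (disc_coord g) = mat2 a b (cnj b) (cnj a)"
    "(cmod a)\<^sup>2 = 1 + (cmod b)\<^sup>2" "a \<noteq> 0"
    by (rule SU11E)
  obtain \<theta> :: real where \<theta>: "u = mat2 (exp (\<i> * \<theta>)) 0 0 (exp (- \<i> * \<theta>))"
    using u(1) by (auto simp: U1_def)
  have "g = mat2 (a * exp (\<i> * \<theta>)) (b * exp (- \<i> * \<theta>))
      (cnj (b * exp (- \<i> * \<theta>))) (cnj (a * exp (\<i> * \<theta>)))"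
    using u(2) unfolding h(1) \<theta> by (simp add: mat2_mult exp_cnj)
  moreover have "(cmod (a * exp (\<i> * \<theta>)))\<^sup>2 = 1 + (cmod (b * exp (- \<i> * \<theta>)))\<^sup>2"
    by (simp add: norm_mult h(2))
  ultimately have "Ad g x0 = mat2 (\<i> * of_real ((cmod (a * exp (\<i> * \<theta>)))\<^sup>2 + (cmod (b * exp (- \<i> * \<theta>)))\<^sup>2))
      (- 2 * \<i> * (a * exp (\<i> * \<theta>) * (b * exp (- \<i> * \<theta>))))
      (2 * \<i> * cnj (a * exp (\<i> * \<theta>) * (b * exp (- \<i> * \<theta>))))
      (- \<i> * of_real ((cmod (a * exp (\<i> * \<theta>)))\<^sup>2 + (cmod (b * exp (- \<i> * \<theta>)))\<^sup>2))"
    by (rule Ad_x0)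
  moreover have "a * exp (\<i> * \<theta>) * (b * exp (- \<i> * \<theta>)) = a * b"
    by (simp add: exp_minus)
  moreover have "cmod (a * exp (\<i> * \<theta>)) = cmod a" "cmod (b * exp (- \<i> * \<theta>)) = cmod b"
    by (simp_all add: norm_mult)
  ultimately show ?thesis unfolding Ad_x0[OF h(1,2)] by (simp only:)
qed

text \<open>A right factor from \<open>U1\<close> multiplies b and cnj a by the same phase, which
  cancels in the quotient.\<close>

lemma disc_coord_eq_if_cls_eq:
  assumes "g \<in> carrier SU11" "h \<in> carrier SU11" "cls g = cls h"
  shows "disc_coord g = disc_coord h"
proof -
  have "g ** mat 1 \<in> cls g" using U1_one unfolding l_coset_SU11 by blast
  then obtain u where "u \<in> U1" "g = h ** u"
    using assms(3) unfolding l_coset_SU11 by auto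
  then obtain \<theta> :: real where \<theta>: "g = h ** mat2 (exp (\<i> * \<theta>)) 0 0 (exp (- \<i> * \<theta>))"
    by (auto simp: U1_def)
  from assms(2) obtain a b where "h = mat2 a b (cnj b) (cnj a)" by (rule SU11E)
  then show ?thesis using \<theta> by (simp add: disc_coord_def mat2_mult exp_cnj)
qed

lemma orbit_x0: "orbit SU11 Ad x0 = (\<lambda>g. Ad g x0) ` carrier SU11"
  by (auto simp: orbit_def)

lemma points_nc_orbit: "points nc_orbit = (\<lambda>g. Ad g x0) ` carrier SU11"
  by (simp add: nc_orbit_def submanifold_def orbit_x0)


section \<open>Smoothness of coordinates and sections\<close>

lemma smooth_disc_section: "smooth_on {z. cmod z < 1} disc_section"
proof -
  have pos: "1 + - (cmod z)\<^sup>2 > 0" if "cmod z < 1" for z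
    using that by (simp add: abs_square_less_1)
  \<comment> \<open>The inverse square root is rewritten as a real power of a positive function, and
    the difference as a sum, to fit \<open>smooth_on_intros\<close> and
    \<open>smooth_on_powr\<close>.\<close>
  let ?c = "\<lambda>z. complex_of_real ((1 + - (cmod z)\<^sup>2) powr (- 1/2))"
  have "smooth_on {z. cmod z < 1} (\<lambda>z. mat2 (?c z) (?c z * z) (?c z * cnj z) (?c z))"
    by (intro smooth_on_intros smooth_on_powr) (rule pos, simp)+
  moreover have "mat2 (?c z) (?c z * z) (?c z * cnj z) (?c z) = disc_section z" if "cmod z < 1" for z
    using pos[OF that] by (simp add: disc_section_def Let_def powr_minus_divide powr_half_sqrt)
  ultimately show ?thesis by (rule smooth_on_eq) simp
qed

lemma smooth_disc_coord: "smooth_on (carrier SU11) disc_coord"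
proof -
  \<comment> \<open>b / cnj a = a b / |a|^2 replaces a complex division by a power of a positive
    real; both sides are 0 if a = 0.\<close>
  let ?f = "\<lambda>g::complex^2^2. g $ 1 $ 2 * g $ 1 $ 1 * of_real ((cmod (g $ 1 $ 1))\<^sup>2 powr - 1)"
  have "smooth_on (carrier SU11) ?f"
    by (intro smooth_on_intros smooth_on_powr) (auto elim!: SU11E)
  moreover have "?f g = disc_coord g" for g
    by (simp add: disc_coord_def powr_minus_divide complex_norm_square field_simps del: of_real_power)
  ultimately show ?thesis by (rule smooth_on_eq)
qed

lemma smooth_orbit_coord: "smooth_on (orbit SU11 Ad x0) orbit_coord"
proof -
  let ?f = "\<lambda>Y::complex^2^2. \<i> * Y $ 1 $ 2 * of_real ((1 + Im (Y $ 1 $ 1)) powr - 1)"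
  have pos: "1 + Im (Y $ 1 $ 1) > 0" if "Y \<in> orbit SU11 Ad x0" for Y
    using that Im_orbit by (fastforce simp: orbit_x0)
  have "smooth_on (orbit SU11 Ad x0) ?f"
    by (intro smooth_on_intros smooth_on_powr pos)
  moreover have "?f Y = orbit_coord Y" if "Y \<in> orbit SU11 Ad x0" for Y
    using pos[OF that] by (simp add: orbit_coord_def powr_minus_divide)
  ultimately show ?thesis by (rule smooth_on_eq)
qed

text \<open>On the group \<open>Ad_x0\<close> gives a polynomial in the entries and their
  conjugates, so \<open>matrix_inv\<close> is never differentiated.\<close>

lemma smooth_Ad_x0: "smooth_on (carrier SU11) (\<lambda>g. Ad g x0)"
proof -
  let ?n = "\<lambda>g::complex^2^2. complex_of_real ((cmod (g $ 1 $ 1))\<^sup>2 + (cmod (g $ 1 $ 2))\<^sup>2)"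
  let ?f = "\<lambda>g::complex^2^2. mat2 (\<i> * ?n g) (- 2 * \<i> * (g $ 1 $ 1 * g $ 1 $ 2))
    (2 * \<i> * cnj (g $ 1 $ 1 * g $ 1 $ 2)) (- \<i> * ?n g)"
  have "smooth_on (carrier SU11) ?f"
    by (intro smooth_on_intros)
  moreover have "?f g = Ad g x0" if "g \<in> carrier SU11" for g
    using that by (rule SU11E) (simp add: Ad_x0)
  ultimately show ?thesis by (rule smooth_on_eq)
qed

section \<open>The disc and the orbit as models of the quotient\<close>

interpretation disc: smooth_section SU11 U1 "{z. cmod z < 1}" disc_section disc_coord
proof
  show "disc_coord g = disc_coord h" if "g \<in> carrier SU11" "h \<in> carrier SU11" "cls g = cls h" for g h
    by (rule disc_coord_eq_if_cls_eq[OF that])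
qed (simp_all add: smooth_disc_section disc_section_in_SU11 smooth_disc_coord disc_coord_in_disc
    disc_coord_section cls_disc_section)

text \<open>The disc section is transported by \<open>orbit_coord\<close>. That the orbit map undoes
  it is \<open>Ad_disc_section\<close>, since the two coordinates correspond by
  \<open>orbit_coord_Ad\<close>.\<close>

interpretation orb: smooth_section SU11 U1 "orbit SU11 Ad x0"
  "\<lambda>Y. disc_section (orbit_coord Y)" "\<lambda>g. Ad g x0"
proof
  show "smooth_on (orbit SU11 Ad x0) (\<lambda>Y. disc_section (orbit_coord Y))"
    by (rule smooth_on_compose[OF smooth_orbit_coord smooth_disc_section])
      (auto simp: orbit_x0 orbit_coord_Ad disc_coord_in_disc)
  show "Ad g x0 = Ad h x0" if "g \<in> carrier SU11" "h \<in> carrier SU11" "cls g = cls h" for g h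
    using Ad_disc_section[OF that(1)] Ad_disc_section[OF that(2)] disc_coord_eq_if_cls_eq[OF that] by simp
qed (auto simp: orbit_x0 orbit_coord_Ad disc_coord_in_disc disc_section_in_SU11 smooth_Ad_x0
    Ad_disc_section cls_disc_section)

lemma bij_disc_orbit: "bij_betw (\<lambda>z. Ad (disc_section z) x0) {z. cmod z < 1} (orbit SU11 Ad x0)"
  by (rule bij_betw_byWitness[where f' = orbit_coord])
    (auto simp: orbit_x0 orbit_coord_Ad disc_coord_in_disc disc_section_in_SU11 disc_coord_section
      Ad_disc_section)

lemma smooth_manifold_disc: "smooth_manifold (submanifold {z. cmod z < 1} :: (complex, complex) charted_space)"
proof (rule smooth_manifold_submanifold)
  have "open {z. cmod z < 1}"
    by (intro open_Collect_less continuous_intros)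
  then have "topological_chart (top_of_set {z. cmod z < 1}) {z. cmod z < 1} (\<lambda>z. z)"
    by (simp add: topological_chart_def subtopology_subtopology homeomorphic_map_id[unfolded id_def])
  moreover have "smooth_on {z. cmod z < 1} (inv_into {z. cmod z < 1} (\<lambda>z. z))"
    using smooth_on_cong[of "{z. cmod z < 1}" "inv_into {z. cmod z < 1} (\<lambda>z. z)" "\<lambda>z. z"]
      inv_into_f_f[of "\<lambda>z. z" "{z. cmod z < 1}"] by (simp add: smooth_on_id)
  ultimately show "({z. cmod z < 1}, \<lambda>z. z) \<in> atlas (submanifold {z. cmod z < 1})"
    by (simp add: atlas_submanifold smooth_on_id)
qed

text \<open>\<open>orbit_coord\<close> is a global chart onto the disc; its inverse
  \<open>?\<tau>\<close> applies the section and then conjugates \<open>x0\<close>.\<close>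

lemma smooth_manifold_nc_orbit: "smooth_manifold nc_orbit"
  unfolding nc_orbit_def
proof (rule smooth_manifold_submanifold)
  let ?O = "orbit SU11 Ad x0" and ?D = "{z. cmod z < 1}" and ?\<tau> = "\<lambda>z. Ad (disc_section z) x0"
  have img: "orbit_coord ` ?O = ?D"
    using disc_section_in_SU11 disc_coord_section
    by (force simp: orbit_x0 orbit_coord_Ad disc_coord_in_disc image_iff)
  have smooth: "smooth_on ?D ?\<tau>"
    by (rule smooth_on_compose[OF smooth_disc_section smooth_Ad_x0]) (auto simp: disc_section_in_SU11)
  have inv: "orbit_coord (?\<tau> z) = z" "?\<tau> z \<in> ?O" if "cmod z < 1" for z
    using that by (simp_all add: orbit_x0 orbit_coord_Ad disc_section_in_SU11 disc_coord_section)
  have "homeomorphic_maps (top_of_set ?O) (top_of_set ?D) orbit_coord ?\<tau>"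
    using smooth_on_imp_continuous_on[OF smooth_orbit_coord] smooth_on_imp_continuous_on[OF smooth] inv
    by (auto simp: homeomorphic_maps_def orbit_x0 orbit_coord_Ad disc_coord_in_disc Ad_disc_section)
  moreover have "open ?D"
    by (intro open_Collect_less continuous_intros)
  ultimately have "topological_chart (top_of_set ?O) ?O orbit_coord"
    using homeomorphic_maps_imp_map unfolding topological_chart_def img
    by (auto simp: subtopology_subtopology)
  moreover have "inj_on orbit_coord ?O"
    by (rule inj_on_inverseI[where g = ?\<tau>]) (auto simp: orbit_x0 orbit_coord_Ad Ad_disc_section)
  then have "inv_into ?O orbit_coord z = ?\<tau> z" if "z \<in> ?D" for z
    using inv_into_f_eq[of orbit_coord ?O "?\<tau> z" z] inv that by simp
  then have "smooth_on ?D (inv_into ?O orbit_coord)"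
    using smooth smooth_on_cong[of ?D "inv_into ?O orbit_coord" ?\<tau>] by simp
  ultimately show "(?O, orbit_coord) \<in> atlas (submanifold ?O)"
    by (simp add: atlas_submanifold img smooth_orbit_coord)
qed

text \<open>The chart comes from the disc instance because the disc is open in its model space,
  whereas the orbit is not open among matrices.\<close>

lemma smooth_manifold_SU11_mod_U1: "smooth_manifold SU11_mod_U1"
  unfolding SU11_mod_U1_def
  by (rule disc.smooth_manifold_cosets) (intro open_Collect_less continuous_intros)

section \<open>Coordinates of the explicit matrices\<close>

lemma tanh_artanh_real:
  assumes "\<bar>r\<bar> < (1::real)"
  shows "tanh (artanh r) = r"
proof -
  have "exp (- 2 * artanh r) = (1 - r) / (1 + r)"
    using assms by (simp add: artanh_def exp_minus)
  then show ?thesis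
    using assms by (simp only: tanh_real_altdef) (simp add: field_simps)
qed

lemma fmat_in_SU11: "fmat \<beta> \<in> carrier SU11"
  \<comment> \<open>The factor \<beta> / |\<beta>| has modulus 1 except at 0, where it is 0 and sinh
    vanishes as well.\<close>
  by (cases "\<beta> = 0")
    (simp_all add: fmat_def mem_SU11_iff norm_mult norm_divide power_mult_distrib cosh_square_eq)

lemma disc_coord_fmat: "disc_coord (fmat \<beta>) = \<beta> / of_real (cmod \<beta>) * of_real (tanh (cmod \<beta>))"
  by (simp add: disc_coord_def fmat_def tanh_def)

lemma hmat_in_SU11: "hmat r \<theta> \<in> carrier SU11"
  by (simp add: hmat_def Let_def mem_SU11_iff norm_mult power_mult_distrib cosh_square_eq exp_cnj)

lemma disc_coord_hmat:
  assumes "0 \<le> r" "r < 1"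
  shows "disc_coord (hmat r \<theta>) = of_real r * exp (\<i> * of_real \<theta>)"
proof -
  have "1/2 * ln ((1 + r) / (1 - r)) = artanh r" by (simp add: artanh_def)
  then have "disc_coord (hmat r \<theta>) = exp (\<i> * of_real \<theta>) * of_real (tanh (artanh r))"
    by (simp only: disc_coord_def hmat_def Let_def mat2_nth) (simp add: tanh_def)
  then show ?thesis using assms by (simp add: tanh_artanh_real)
qed

text \<open>The map keeps directions and applies \<open>tanh\<close> to the radius; the inverse
  applies \<open>artanh\<close> to the radius.\<close>

lemma bij_radial_tanh:
  "bij_betw (\<lambda>\<beta>. \<beta> / of_real (cmod \<beta>) * of_real (tanh (cmod \<beta>))) UNIV {z. cmod z < 1}"
proof (rule bij_betw_byWitness[where f' = "\<lambda>z. z / of_real (cmod z) * of_real (artanh (cmod z))"])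
  have T: "cmod (\<beta> / of_real (cmod \<beta>) * of_real (tanh (cmod \<beta>))) = tanh (cmod \<beta>)" for \<beta>
    by (cases "\<beta> = 0") (simp_all add: norm_mult norm_divide)
  show "(\<lambda>\<beta>. \<beta> / of_real (cmod \<beta>) * of_real (tanh (cmod \<beta>))) ` UNIV \<subseteq> {z. cmod z < 1}"
    using T tanh_real_lt_1 by auto
  show "\<forall>\<beta>\<in>UNIV. (\<lambda>z. z / of_real (cmod z) * of_real (artanh (cmod z)))
      (\<beta> / of_real (cmod \<beta>) * of_real (tanh (cmod \<beta>))) = \<beta>"
    unfolding T by (auto simp: artanh_tanh_real)
  show "\<forall>z\<in>{z. cmod z < 1}. (\<lambda>\<beta>. \<beta> / of_real (cmod \<beta>) * of_real (tanh (cmod \<beta>)))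
      (z / of_real (cmod z) * of_real (artanh (cmod z))) = z"
  proof clarify
    fix z :: complex assume z: "cmod z < 1"
    show "z / of_real (cmod z) * of_real (artanh (cmod z)) /
        of_real (cmod (z / of_real (cmod z) * of_real (artanh (cmod z)))) *
        of_real (tanh (cmod (z / of_real (cmod z) * of_real (artanh (cmod z))))) = z"
    proof (cases "z = 0")
      case False
      have "tanh (artanh (cmod z)) = cmod z" using z by (simp add: tanh_artanh_real)
      \<comment> \<open>Positivity makes this number the modulus of the preimage itself, with no
        absolute value, and allows cancelling it.\<close>
      with False have "artanh (cmod z) > 0" by (metis tanh_real_pos_iff zero_less_norm_iff)
      then have "cmod (z / of_real (cmod z) * of_real (artanh (cmod z))) = artanh (cmod z)"
        using False by (simp add: norm_mult norm_divide)
      with False \<open>artanh (cmod z) > 0\<close> \<open>tanh (artanh (cmod z)) = cmod z\<close> show ?thesis by simp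
    qed simp
  qed
qed auto

section \<open>The diffeomorphisms and their formulas\<close>

theorem proposition1:
  shows "(\<forall>\<beta>. fmat \<beta> \<in> carrier SU11) \<and>
    (\<forall>r \<theta>. 0 \<le> r \<and> r < 1 \<longrightarrow> hmat r \<theta> \<in> carrier SU11) \<and>
    bij_betw (\<lambda>\<beta>. Ad (fmat \<beta>) x0) UNIV (points nc_orbit) \<and>
    (\<exists>\<Phi> \<Psi>.
       diffeomorphism nc_orbit SU11_mod_U1 \<Phi> \<and>
       diffeomorphism SU11_mod_U1 H2 \<Psi> \<and>
       (\<forall>\<beta>. \<Phi> (Ad (fmat \<beta>) x0) = cls (fmat \<beta>) \<and>
            \<Psi> (cls (fmat \<beta>)) = \<beta> / of_real (cmod \<beta>) * of_real (tanh (cmod \<beta>))) \<and>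
       (\<forall>r \<theta>. 0 \<le> r \<and> r < 1 \<longrightarrow>
            inv_into (points SU11_mod_U1) \<Psi> (of_real r * exp (\<i> * of_real \<theta>)) = cls (hmat r \<theta>) \<and>
            inv_into (points nc_orbit) \<Phi> (cls (hmat r \<theta>)) = Ad (hmat r \<theta>) x0))"
proof (intro conjI exI allI impI)
  \<comment> \<open>\<open>disc.to_coset\<close> runs from the disc to the cosets, so its inverse is
    the required map, while \<open>orb.to_coset\<close> already has the right direction.\<close>
  let ?\<Psi> = "inv_into {z. cmod z < 1} disc.to_coset"
  \<comment> \<open>The parameter is sent to its point of the disc and from there to the orbit;
    \<open>Ad_disc_section\<close> identifies the result with the conjugate by
    \<open>fmat \<beta>\<close>.\<close>
  have "bij_betw ((\<lambda>z. Ad (disc_section z) x0) \<circ> (\<lambda>\<beta>. disc_coord (fmat \<beta>))) UNIV (orbit SU11 Ad x0)"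
    using bij_betw_trans[OF bij_radial_tanh bij_disc_orbit] by (simp add: disc_coord_fmat)
  then show "bij_betw (\<lambda>\<beta>. Ad (fmat \<beta>) x0) UNIV (points nc_orbit)"
    by (simp add: o_def Ad_disc_section fmat_in_SU11 points_nc_orbit orbit_x0)
  show "diffeomorphism nc_orbit SU11_mod_U1 orb.to_coset"
    using orb.diffeomorphism_to_coset smooth_manifold_nc_orbit smooth_manifold_SU11_mod_U1
    by (simp add: nc_orbit_def SU11_mod_U1_def)
  have "diffeomorphism H2 SU11_mod_U1 disc.to_coset"
    using disc.diffeomorphism_to_coset smooth_manifold_disc smooth_manifold_SU11_mod_U1
    by (simp add: H2_def SU11_mod_U1_def)
  from diffeomorphism_inv_into[OF this] show "diffeomorphism SU11_mod_U1 H2 ?\<Psi>"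
    by (simp add: H2_def submanifold_def)
  fix \<beta>
  show "orb.to_coset (Ad (fmat \<beta>) x0) = cls (fmat \<beta>)"
    by (rule orb.to_coset_m[OF fmat_in_SU11])
  show "?\<Psi> (cls (fmat \<beta>)) = \<beta> / of_real (cmod \<beta>) * of_real (tanh (cmod \<beta>))"
    by (simp add: disc.inv_into_to_coset[OF fmat_in_SU11] disc_coord_fmat)
next
  fix r \<theta> :: real assume r: "0 \<le> r \<and> r < 1"
  let ?\<Psi> = "inv_into {z. cmod z < 1} disc.to_coset"
  have bij: "bij_betw disc.to_coset {z. cmod z < 1} (points SU11_mod_U1)"
    by (simp add: bij_betw_def disc.inj_on_to_coset disc.to_coset_image SU11_mod_U1_def
        points_homogeneous_space)
  \<comment> \<open>Inverting \<open>?\<Psi>\<close> restores \<open>disc.to_coset\<close> on the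
    disc; evaluated at the coordinate of a group element it returns that element's coset.\<close>
  have "inv_into (points SU11_mod_U1) ?\<Psi> (disc_coord (hmat r \<theta>)) = disc.to_coset (disc_coord (hmat r \<theta>))"
    using inv_into_inv_into_eq[OF bij] disc_coord_in_disc[OF hmat_in_SU11] by simp
  also have "\<dots> = cls (hmat r \<theta>)" by (rule disc.to_coset_m[OF hmat_in_SU11])
  finally show "inv_into (points SU11_mod_U1) ?\<Psi> (of_real r * exp (\<i> * of_real \<theta>)) = cls (hmat r \<theta>)"
    using r by (simp add: disc_coord_hmat)
  show "inv_into (points nc_orbit) orb.to_coset (cls (hmat r \<theta>)) = Ad (hmat r \<theta>) x0"
    using orb.inv_into_to_coset[OF hmat_in_SU11] by (simp add: points_nc_orbit orbit_x0)
qed (simp_all add: fmat_in_SU11 hmat_in_SU11)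

end
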